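(* There is a functor $Z$ from the category of 3-dimensional complex vector spaces with complex volume form, with linear operators preserving the complex volume form as morphisms, to the category of complex algebras isomorphic to the bioctonions $\mathbb{O}_{\mathbb{C}}$ equipped with a chosen nontrivial square root of $-1$, with (complex) algebra isomorphisms preserving the chosen square root of $-1$ as morphisms. This functor $Z$ is an equivalence of categories.
   Context: An algebra means a finite-dimensional vector space with a bilinear, not necessarily associative, product and a unit. The bioctonions $\mathbb{O}_{\mathbb{C}}\cong\mathbb{C}\otimes_{\mathbb{R}}\mathbb{O}$ ($\mathbb{O}$ the octonions) are the complex algebra of matrices $\begin{pmatrix}\alpha&\mathbf{a}\\ \mathbf{a}'&\alpha'\end{pmatrix}$ with $\alpha,\alpha'\in\mathbb{C}$, $\mathbf{a},\mathbf{a}'\in\mathbb{C}^3$, with product $$\begin{pmatrix}\alpha&\mathbf{a}\\ \mathbf{a}'&\alpha'\end{pmatrix}\begin{pmatrix}\beta&\mathbf{b}\\ \mathbf{b}'&\beta'\end{pmatrix}=\begin{pmatrix}\alpha\beta+\mathbf{a}\cdot\mathbf{b}'&\alpha\mathbf{b}+\beta'\mathbf{a}-\mathbf{a}'\times\mathbf{b}'\\ \beta\mathbf{a}'+\alpha'\mathbf{b}'+\mathbf{a}\times\mathbf{b}&\mathbf{a}'\cdot\mathbf{b}+\alpha'\beta'\end{pmatrix},$$ with complex-bilinear dot product and standard cross product on $\mathbb{C}^3$. A square root of $-1$ in an algebra isomorphic to $\mathbb{O}_{\mathbb{C}}$ is nontrivial if it is not $\pm i$ times the unit. A complex volume form on a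 3-dimensional complex vector space $V$ is a nonzero $\omega\in\Lambda^3V^*$; a linear map $f\colon V\to V'$ preserves complex volume forms if $f^*\omega'=\omega$. *)

theory Defs
  imports "HOL-Analysis.Cartesian_Space" "Jordan_Normal_Form.VS_Connect"
begin

no_notation Matrix.vec_index (infixl \<open>$\<close> 100)

section \<open>Categories, functors, equivalences\<close>

text \<open>
  A category consists of a set of objects together with hom-sets. The composition of
  \<open>f \<in> Hom C X Y\<close> and \<open>g \<in> Hom C Y Z\<close> is \<open>Comp C X Y Z g f\<close>; it and the arrow maps of
  functors take the objects as arguments, because hom-sets of different pairs of objects may
  overlap.
\<close>

record ('o, 'm) category =
  Obj :: "'o set"
  Hom :: "'o \<Rightarrow> 'o \<Rightarrow> 'm set"
  Id_mor :: "'o \<Rightarrow> 'm"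
  Comp :: "'o \<Rightarrow> 'o \<Rightarrow> 'o \<Rightarrow> 'm \<Rightarrow> 'm \<Rightarrow> 'm"

locale category =
  fixes C :: "('o, 'm) category"
  assumes Id_mor_in_Hom: "X \<in> Obj C \<Longrightarrow> Id_mor C X \<in> Hom C X X"
    and Comp_in_Hom:
      "\<lbrakk>X \<in> Obj C; Y \<in> Obj C; Z \<in> Obj C; f \<in> Hom C X Y; g \<in> Hom C Y Z\<rbrakk>
        \<Longrightarrow> Comp C X Y Z g f \<in> Hom C X Z"
    and Id_mor_left: "\<lbrakk>X \<in> Obj C; Y \<in> Obj C; f \<in> Hom C X Y\<rbrakk> \<Longrightarrow> Comp C X Y Y (Id_mor C Y) f = f"
    and Id_mor_right: "\<lbrakk>X \<in> Obj C; Y \<in> Obj C; f \<in> Hom C X Y\<rbrakk> \<Longrightarrow> Comp C X X Y f (Id_mor C X) = f"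
    and Comp_assoc:
      "\<lbrakk>W \<in> Obj C; X \<in> Obj C; Y \<in> Obj C; Z \<in> Obj C;
        f \<in> Hom C W X; g \<in> Hom C X Y; h \<in> Hom C Y Z\<rbrakk>
        \<Longrightarrow> Comp C W X Z (Comp C X Y Z h g) f = Comp C W Y Z h (Comp C W X Y g f)"

definition isos :: "('o, 'm) category \<Rightarrow> 'o \<Rightarrow> 'o \<Rightarrow> 'm set" where
  "isos C X Y = {f \<in> Hom C X Y. \<exists>g \<in> Hom C Y X.
     Comp C X Y X g f = Id_mor C X \<and> Comp C Y X Y f g = Id_mor C Y}"

record ('o, 'm, 'p, 'n) cat_functor =
  omap :: "'o \<Rightarrow> 'p"
  amap :: "'o \<Rightarrow> 'o \<Rightarrow> 'm \<Rightarrow> 'n"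

locale cat_functor = C: category C + D: category D
  for C :: "('o, 'm) category" and D :: "('p, 'n) category" +
  fixes F :: "('o, 'm, 'p, 'n) cat_functor"
  assumes omap_in_Obj: "X \<in> Obj C \<Longrightarrow> omap F X \<in> Obj D"
    and amap_in_Hom:
      "\<lbrakk>X \<in> Obj C; Y \<in> Obj C; f \<in> Hom C X Y\<rbrakk> \<Longrightarrow> amap F X Y f \<in> Hom D (omap F X) (omap F Y)"
    and amap_Id_mor: "X \<in> Obj C \<Longrightarrow> amap F X X (Id_mor C X) = Id_mor D (omap F X)"
    and amap_Comp:
      "\<lbrakk>X \<in> Obj C; Y \<in> Obj C; Z \<in> Obj C; f \<in> Hom C X Y; g \<in> Hom C Y Z\<rbrakk>
        \<Longrightarrow> amap F X Z (Comp C X Y Z g f) =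
            Comp D (omap F X) (omap F Y) (omap F Z) (amap F Y Z g) (amap F X Y f)"

definition id_functor :: "('o, 'm, 'o, 'm) cat_functor" where
  "id_functor = \<lparr>omap = (\<lambda>X. X), amap = (\<lambda>X Y f. f)\<rparr>"

definition comp_functor ::
  "('p, 'n, 'q, 'l) cat_functor \<Rightarrow> ('o, 'm, 'p, 'n) cat_functor \<Rightarrow> ('o, 'm, 'q, 'l) cat_functor" where
  "comp_functor G F =
     \<lparr>omap = (\<lambda>X. omap G (omap F X)),
      amap = (\<lambda>X Y f. amap G (omap F X) (omap F Y) (amap F X Y f))\<rparr>"

locale natural_isomorphism = F: cat_functor C D F + G: cat_functor C D G
  for C :: "('o, 'm) category" and D :: "('p, 'n) category" and F G +
  fixes \<eta> :: "'o \<Rightarrow> 'n"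
  assumes component_iso: "X \<in> Obj C \<Longrightarrow> \<eta> X \<in> isos D (omap F X) (omap G X)"
    and naturality:
      "\<lbrakk>X \<in> Obj C; Y \<in> Obj C; f \<in> Hom C X Y\<rbrakk>
        \<Longrightarrow> Comp D (omap F X) (omap F Y) (omap G Y) (\<eta> Y) (amap F X Y f) =
            Comp D (omap F X) (omap G X) (omap G Y) (amap G X Y f) (\<eta> X)"

definition is_equivalence ::
  "('o, 'm) category \<Rightarrow> ('p, 'n) category \<Rightarrow> ('o, 'm, 'p, 'n) cat_functor \<Rightarrow> bool" where
  "is_equivalence C D F \<longleftrightarrow> cat_functor C D F \<and>
     (\<exists>G. cat_functor D C G \<and>
        (\<exists>\<eta>. natural_isomorphism C C id_functor (comp_functor G F) \<eta>) \<and>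
        (\<exists>\<epsilon>. natural_isomorphism D D (comp_functor F G) id_functor \<epsilon>))"


section \<open>Complex vector spaces with a volume form\<close>

text \<open>
  Complex vector spaces are the \<^locale>\<open>vectorspace\<close>s over \<^term>\<open>class_ring :: complex ring\<close>.
  Their records also carry the fields \<open>mult\<close> and \<open>one\<close>, which are irrelevant here and which hold
  the product and the unit of an algebra below. Operations and forms matter only on the carrier;
  two objects that differ only in irrelevant values are isomorphic through the identity map.
\<close>

record 'a volume_space = "(complex, 'a) module" +
  vol :: "'a \<Rightarrow> 'a \<Rightarrow> 'a \<Rightarrow> complex"

definition linear_form :: "(complex, 'a, 'r) module_scheme \<Rightarrow> ('a \<Rightarrow> complex) \<Rightarrow> bool" where
  "linear_form V \<phi> \<longleftrightarrow>
     (\<forall>x \<in> carrier V. \<forall>y \<in> carrier V. \<phi> (x \<oplus>\<^bsub>V\<^esub> y) = \<phi> x + \<phi> y) \<and>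
     (\<forall>c. \<forall>x \<in> carrier V. \<phi> (c \<odot>\<^bsub>V\<^esub> x) = c * \<phi> x)"

text \<open>The elements of \<open>\<Lambda>\<^sup>3V\<^sup>*\<close>, as alternating trilinear forms.\<close>

definition alternating_3form ::
  "(complex, 'a, 'r) module_scheme \<Rightarrow> ('a \<Rightarrow> 'a \<Rightarrow> 'a \<Rightarrow> complex) \<Rightarrow> bool" where
  "alternating_3form V \<omega> \<longleftrightarrow>
     (\<forall>x \<in> carrier V. \<forall>y \<in> carrier V.
        linear_form V (\<lambda>z. \<omega> z x y) \<and> linear_form V (\<lambda>z. \<omega> x z y) \<and> linear_form V (\<lambda>z. \<omega> x y z) \<and>
        \<omega> x x y = 0 \<and> \<omega> x y x = 0 \<and> \<omega> y x x = 0)"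

definition volume_form ::
  "(complex, 'a, 'r) module_scheme \<Rightarrow> ('a \<Rightarrow> 'a \<Rightarrow> 'a \<Rightarrow> complex) \<Rightarrow> bool" where
  "volume_form V \<omega> \<longleftrightarrow> alternating_3form V \<omega> \<and>
     (\<exists>x \<in> carrier V. \<exists>y \<in> carrier V. \<exists>z \<in> carrier V. \<omega> x y z \<noteq> 0)"

definition preserves_vol :: "'a volume_space \<Rightarrow> 'a volume_space \<Rightarrow> ('a \<Rightarrow> 'a) \<Rightarrow> bool" where
  "preserves_vol V W f \<longleftrightarrow>
     (\<forall>x \<in> carrier V. \<forall>y \<in> carrier V. \<forall>z \<in> carrier V. vol W (f x) (f y) (f z) = vol V x y z)"

text \<open>
  Morphisms are required to be \<^const>\<open>extensional\<close>, so that two morphisms are equal as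
  soon as they agree on the carrier.
\<close>

definition volume_space_cat :: "('a volume_space, 'a \<Rightarrow> 'a) category" where
  "volume_space_cat =
     \<lparr>Obj = {V. vectorspace class_ring V \<and> vectorspace.fin_dim class_ring V \<and>
                vectorspace.dim class_ring V = 3 \<and> volume_form V (vol V)},
      Hom = (\<lambda>V W. {f \<in> module_hom class_ring V W. f \<in> extensional (carrier V) \<and>
                      preserves_vol V W f}),
      Id_mor = (\<lambda>V. restrict (\<lambda>x. x) (carrier V)),
      Comp = (\<lambda>U V W g f. compose (carrier U) g f)\<rparr>"


section \<open>Complex algebras and the bioctonions\<close>

locale complex_algebra = vectorspace class_ring A
  for A :: "(complex, 'a, 'r) module_scheme" +
  assumes finite_dimensional: "fin_dim"
    and mult_closed: "\<lbrakk>x \<in> carrier A; y \<in> carrier A\<rbrakk> \<Longrightarrow> x \<otimes>\<^bsub>A\<^esub> y \<in> carrier A"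
    and mult_add_left:
      "\<lbrakk>x \<in> carrier A; y \<in> carrier A; z \<in> carrier A\<rbrakk>
        \<Longrightarrow> (x \<oplus>\<^bsub>A\<^esub> y) \<otimes>\<^bsub>A\<^esub> z = x \<otimes>\<^bsub>A\<^esub> z \<oplus>\<^bsub>A\<^esub> y \<otimes>\<^bsub>A\<^esub> z"
    and mult_add_right:
      "\<lbrakk>x \<in> carrier A; y \<in> carrier A; z \<in> carrier A\<rbrakk>
        \<Longrightarrow> x \<otimes>\<^bsub>A\<^esub> (y \<oplus>\<^bsub>A\<^esub> z) = x \<otimes>\<^bsub>A\<^esub> y \<oplus>\<^bsub>A\<^esub> x \<otimes>\<^bsub>A\<^esub> z"
    and mult_smult_left:
      "\<lbrakk>x \<in> carrier A; y \<in> carrier A\<rbrakk> \<Longrightarrow> (c \<odot>\<^bsub>A\<^esub> x) \<otimes>\<^bsub>A\<^esub> y = c \<odot>\<^bsub>A\<^esub> (x \<otimes>\<^bsub>A\<^esub> y)"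
    and mult_smult_right:
      "\<lbrakk>x \<in> carrier A; y \<in> carrier A\<rbrakk> \<Longrightarrow> x \<otimes>\<^bsub>A\<^esub> (c \<odot>\<^bsub>A\<^esub> y) = c \<odot>\<^bsub>A\<^esub> (x \<otimes>\<^bsub>A\<^esub> y)"
    and unit_closed: "\<one>\<^bsub>A\<^esub> \<in> carrier A"
    and unit_left: "x \<in> carrier A \<Longrightarrow> \<one>\<^bsub>A\<^esub> \<otimes>\<^bsub>A\<^esub> x = x"
    and unit_right: "x \<in> carrier A \<Longrightarrow> x \<otimes>\<^bsub>A\<^esub> \<one>\<^bsub>A\<^esub> = x"

definition algebra_isos ::
  "(complex, 'a, 'r) module_scheme \<Rightarrow> (complex, 'b, 's) module_scheme \<Rightarrow> ('a \<Rightarrow> 'b) set" where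
  "algebra_isos A B = {f \<in> module_hom class_ring A B.
     bij_betw f (carrier A) (carrier B) \<and>
     (\<forall>x \<in> carrier A. \<forall>y \<in> carrier A. f (x \<otimes>\<^bsub>A\<^esub> y) = f x \<otimes>\<^bsub>B\<^esub> f y) \<and>
     f \<one>\<^bsub>A\<^esub> = \<one>\<^bsub>B\<^esub>}"

text \<open>Both products are complex-bilinear; the dot product involves no conjugation.\<close>

definition cdot :: "complex ^ 3 \<Rightarrow> complex ^ 3 \<Rightarrow> complex" where
  "cdot a b = (\<Sum>i \<in> UNIV. a $ i * b $ i)"

definition ccross :: "complex ^ 3 \<Rightarrow> complex ^ 3 \<Rightarrow> complex ^ 3" where
  "ccross a b = vector [a $ 2 * b $ 3 - a $ 3 * b $ 2,
                        a $ 3 * b $ 1 - a $ 1 * b $ 3,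
                        a $ 1 * b $ 2 - a $ 2 * b $ 1]"

text \<open>
  The tuple \<open>(\<alpha>, a, a', \<alpha>')\<close> stands for the matrix with rows \<open>(\<alpha>, a)\<close> and \<open>(a', \<alpha>')\<close>.
\<close>

type_synonym bioctonion = "complex \<times> (complex ^ 3) \<times> (complex ^ 3) \<times> complex"

fun bioct_mult :: "bioctonion \<Rightarrow> bioctonion \<Rightarrow> bioctonion" where
  "bioct_mult (\<alpha>, a, a', \<alpha>') (\<beta>, b, b', \<beta>') =
     (\<alpha> * \<beta> + cdot a b',
      \<alpha> *s b + \<beta>' *s a - ccross a' b',
      \<beta> *s a' + \<alpha>' *s b' + ccross a b,
      cdot a' b + \<alpha>' * \<beta>')"

fun bioct_smult :: "complex \<Rightarrow> bioctonion \<Rightarrow> bioctonion" where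
  "bioct_smult c (\<alpha>, a, a', \<alpha>') = (c * \<alpha>, c *s a, c *s a', c * \<alpha>')"

definition bioctonions :: "(complex, bioctonion) module" where
  "bioctonions = \<lparr>carrier = UNIV, mult = bioct_mult, one = (1, 0, 0, 1),
                  zero = 0, add = (+), smult = bioct_smult\<rparr>"

definition nontrivial_root :: "(complex, 'a, 'r) module_scheme \<Rightarrow> 'a \<Rightarrow> bool" where
  "nontrivial_root A j \<longleftrightarrow> j \<in> carrier A \<and> j \<otimes>\<^bsub>A\<^esub> j = \<ominus>\<^bsub>A\<^esub> \<one>\<^bsub>A\<^esub> \<and>
     j \<noteq> \<i> \<odot>\<^bsub>A\<^esub> \<one>\<^bsub>A\<^esub> \<and> j \<noteq> (- \<i>) \<odot>\<^bsub>A\<^esub> \<one>\<^bsub>A\<^esub>"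

record 'a rooted_algebra = "(complex, 'a) module" +
  root :: 'a

definition rooted_bioctonion_cat :: "('a rooted_algebra, 'a \<Rightarrow> 'a) category" where
  "rooted_bioctonion_cat =
     \<lparr>Obj = {A. complex_algebra A \<and> algebra_isos A bioctonions \<noteq> {} \<and>
                nontrivial_root A (root A)},
      Hom = (\<lambda>A B. {f \<in> algebra_isos A B. f \<in> extensional (carrier A) \<and> f (root A) = root B}),
      Id_mor = (\<lambda>A. restrict (\<lambda>x. x) (carrier A)),
      Comp = (\<lambda>A B C g f. compose (carrier A) g f)\<rparr>"

end

theory Submission
  imports Defs "HOL-Analysis.Determinants"
begin

text \<open>
  Both categories are connected groupoids with the automorphism group \<open>SL\<^sub>3(\<complex>)\<close>, and this is what
  makes them equivalent.

  A three-dimensional space with a volume form has a basis of volume 1. It therefore looks like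
  \<open>\<complex>\<^sup>3\<close> with the determinant form, and in such coordinates the volume preserving linear maps are the
  matrices of determinant 1 (\<open>volume_frame_exists\<close>, \<open>volume_space_Hom_iff\<close>).

  On the algebra side, a matrix \<open>M\<close> of determinant 1 acts on the bioctonions by \<open>M\<close> on the upper
  right corner and by its cofactor matrix, which is the inverse transpose, on the lower left one.
  These are exactly the automorphisms that fix \<open>diag(i, -i)\<close>: such an automorphism fixes the two
  idempotents \<open>diag(1, 0)\<close> and \<open>diag(0, 1)\<close>, hence respects the Peirce decomposition given by the
  four matrix entries, and the products between the two off-diagonal corners force the action on
  the lower one to be the cofactor matrix and the determinant to be 1
  (\<open>automorphism_fixing_standard_root\<close>). Moreover the automorphism group of the bioctonions acts
  transitively on the nontrivial square roots of \<open>-1\<close> (\<open>root_in_standard_orbit\<close>), so that every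
  rooted algebra looks like the bioctonions with the root \<open>diag(i, -i)\<close> (\<open>rooted_frame_exists\<close>).

  The categorical part is the notion of a category framed by a monoid: every object has a chosen
  identification with one model, and in these coordinates the morphisms between any two objects
  are the elements of the monoid. Nonempty categories framed by the same monoid are equivalent
  (\<open>framed_categories_equivalent\<close>), by a functor that sends a morphism to the one with the same
  coordinates. Intrinsically, that functor is \<open>V \<mapsto> \<complex> \<oplus> V \<oplus> \<Lambda>\<^sup>2V \<oplus> \<complex>\<close> up to natural isomorphism; the
  cofactor matrix is the action on \<open>\<Lambda>\<^sup>2V\<close>.
\<close>

section \<open>Categories framed by a monoid\<close>

lemma comp_functor_cat_functor:
  assumes "cat_functor C D F" "cat_functor D E F'"
  shows "cat_functor C E (comp_functor F' F)"
proof -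
  interpret F: cat_functor C D F by fact
  interpret F': cat_functor D E F' by fact
  show ?thesis
    by unfold_locales
      (simp_all add: comp_functor_def F.omap_in_Obj F.amap_in_Hom F.amap_Id_mor F.amap_Comp
        F'.omap_in_Obj F'.amap_in_Hom F'.amap_Id_mor F'.amap_Comp)
qed

text \<open>
  Every object \<open>X\<close> is identified, by the bijection \<open>frame X\<close>, with one fixed model \<open>'c\<close>, on which the
  monoid \<open>G\<close> acts faithfully. In these coordinates every hom-set is all of \<open>G\<close>. The category axioms
  follow from this.
\<close>

locale framed_category = monoid G
  for G :: "'g monoid" +
  fixes C :: "('o, 'a \<Rightarrow> 'a) category"
    and carr :: "'o \<Rightarrow> 'a set"
    and frame :: "'o \<Rightarrow> 'c \<Rightarrow> 'a"
    and act :: "'g \<Rightarrow> 'c \<Rightarrow> 'c"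
  assumes frame_bij: "X \<in> Obj C \<Longrightarrow> bij_betw (frame X) UNIV (carr X)"
    and Hom_iff:
      "\<lbrakk>X \<in> Obj C; Y \<in> Obj C\<rbrakk>
        \<Longrightarrow> f \<in> Hom C X Y \<longleftrightarrow> f \<in> extensional (carr X) \<and>
              (\<exists>g \<in> carrier G. \<forall>x. f (frame X x) = frame Y (act g x))"
    and Id_mor_eq: "Id_mor C X = restrict (\<lambda>x. x) (carr X)"
    and Comp_eq: "Comp C X Y Z f f' = compose (carr X) f f'"
    and act_one: "act \<one>\<^bsub>G\<^esub> x = x"
    and act_mult:
      "\<lbrakk>g \<in> carrier G; h \<in> carrier G\<rbrakk> \<Longrightarrow> act (g \<otimes>\<^bsub>G\<^esub> h) x = act g (act h x)"
    and act_faithful: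
      "\<lbrakk>g \<in> carrier G; h \<in> carrier G; \<And>x. act g x = act h x\<rbrakk> \<Longrightarrow> g = h"
begin

text \<open>
  The element of \<open>G\<close> that a morphism becomes in coordinates. Together with its inverse \<open>arrow\<close> below
  it reduces statements about morphisms to computations in \<open>G\<close> (\<open>Hom_eqI\<close>, \<open>coord_Comp\<close>).
\<close>

definition coord :: "'o \<Rightarrow> 'o \<Rightarrow> ('a \<Rightarrow> 'a) \<Rightarrow> 'g" where
  "coord X Y f = (THE g. g \<in> carrier G \<and> (\<forall>x. f (frame X x) = frame Y (act g x)))"

definition arrow :: "'o \<Rightarrow> 'o \<Rightarrow> 'g \<Rightarrow> 'a \<Rightarrow> 'a" where
  "arrow X Y g = restrict (\<lambda>z. frame Y (act g (inv_into UNIV (frame X) z))) (carr X)"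

lemma frame_inj: "X \<in> Obj C \<Longrightarrow> frame X x = frame X y \<longleftrightarrow> x = y"
  using frame_bij[of X] by (auto simp: bij_betw_def inj_eq)

lemma frame_in_carr: "X \<in> Obj C \<Longrightarrow> frame X x \<in> carr X"
  using frame_bij[of X] by (auto simp: bij_betw_def)

lemma carr_frameE:
  assumes "X \<in> Obj C" "z \<in> carr X"
  obtains x where "z = frame X x"
  using assms frame_bij[of X] by (auto simp: bij_betw_def)

lemma coord_eqI:
  assumes "Y \<in> Obj C" "g \<in> carrier G" "\<And>x. f (frame X x) = frame Y (act g x)"
  shows "coord X Y f = g"
  unfolding coord_def
proof (rule the_equality)
  fix h assume "h \<in> carrier G \<and> (\<forall>x. f (frame X x) = frame Y (act h x))"
  with assms show "h = g"
    by (intro act_faithful) (simp_all add: frame_inj)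
qed (use assms in simp)

lemma
  assumes "X \<in> Obj C" "Y \<in> Obj C" "f \<in> Hom C X Y"
  shows coord_in_carrier: "coord X Y f \<in> carrier G"
    and apply_frame: "f (frame X x) = frame Y (act (coord X Y f) x)"
proof -
  obtain g where g: "g \<in> carrier G" "\<And>x. f (frame X x) = frame Y (act g x)"
    using assms Hom_iff by blast
  moreover from this have "coord X Y f = g"
    using assms(2) by (intro coord_eqI)
  ultimately show "coord X Y f \<in> carrier G" "f (frame X x) = frame Y (act (coord X Y f) x)"
    by simp_all
qed

lemma arrow_frame: "X \<in> Obj C \<Longrightarrow> arrow X Y g (frame X x) = frame Y (act g x)"
  using frame_bij[of X] by (simp add: arrow_def frame_in_carr inv_f_f bij_betw_def)

lemma arrow_in_Hom:
  assumes "X \<in> Obj C" "Y \<in> Obj C" "g \<in> carrier G"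
  shows "arrow X Y g \<in> Hom C X Y"
  unfolding Hom_iff[OF assms(1,2)]
proof
  show "arrow X Y g \<in> extensional (carr X)"
    by (simp add: arrow_def)
qed (use assms in \<open>auto simp: arrow_frame\<close>)

lemma coord_arrow:
  "\<lbrakk>X \<in> Obj C; Y \<in> Obj C; g \<in> carrier G\<rbrakk> \<Longrightarrow> coord X Y (arrow X Y g) = g"
  by (intro coord_eqI) (simp_all add: arrow_frame)

lemma Hom_eqI:
  assumes "X \<in> Obj C" "Y \<in> Obj C" "f \<in> Hom C X Y" "f' \<in> Hom C X Y"
    and "coord X Y f = coord X Y f'"
  shows "f = f'"
proof (rule extensionalityI)
  show "f \<in> extensional (carr X)" "f' \<in> extensional (carr X)"
    using assms by (simp_all add: Hom_iff)
  fix z assume "z \<in> carr X"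
  then obtain x where "z = frame X x"
    using assms(1) by (elim carr_frameE)
  then show "f z = f' z"
    using assms by (simp add: apply_frame[of X Y])
qed

lemma Id_mor_Hom: "X \<in> Obj C \<Longrightarrow> Id_mor C X \<in> Hom C X X"
  by (auto simp: Hom_iff Id_mor_eq frame_in_carr act_one intro!: bexI[of _ "\<one>\<^bsub>G\<^esub>"])

lemma coord_Id_mor: "X \<in> Obj C \<Longrightarrow> coord X X (Id_mor C X) = \<one>\<^bsub>G\<^esub>"
  by (intro coord_eqI) (simp_all add: Id_mor_eq frame_in_carr act_one)

lemma Comp_frame:
  assumes "X \<in> Obj C" "Y \<in> Obj C" "Z \<in> Obj C" "f \<in> Hom C X Y" "g \<in> Hom C Y Z"
  shows "Comp C X Y Z g f (frame X x) = frame Z (act (coord Y Z g \<otimes>\<^bsub>G\<^esub> coord X Y f) x)"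
  using assms
  by (simp add: Comp_eq compose_eq frame_in_carr apply_frame[of X Y] apply_frame[of Y Z]
      act_mult coord_in_carrier)

lemma Comp_Hom:
  assumes "X \<in> Obj C" "Y \<in> Obj C" "Z \<in> Obj C" "f \<in> Hom C X Y" "g \<in> Hom C Y Z"
  shows "Comp C X Y Z g f \<in> Hom C X Z"
  unfolding Hom_iff[OF assms(1,3)]
  using assms Comp_frame[OF assms] by (auto simp: Comp_eq coord_in_carrier)

lemma coord_Comp:
  assumes "X \<in> Obj C" "Y \<in> Obj C" "Z \<in> Obj C" "f \<in> Hom C X Y" "g \<in> Hom C Y Z"
  shows "coord X Z (Comp C X Y Z g f) = coord Y Z g \<otimes>\<^bsub>G\<^esub> coord X Y f"
  using assms by (intro coord_eqI Comp_frame m_closed coord_in_carrier)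

sublocale category C
proof
  fix X Y f assume XY: "X \<in> Obj C" "Y \<in> Obj C" and f: "f \<in> Hom C X Y"
  show "Comp C X Y Y (Id_mor C Y) f = f" "Comp C X X Y f (Id_mor C X) = f"
    by (rule Hom_eqI[OF XY];
        simp add: XY f Comp_Hom Id_mor_Hom coord_Comp coord_Id_mor coord_in_carrier)+
next
  fix W X Y Z f g h
  assume "W \<in> Obj C" "X \<in> Obj C" "Y \<in> Obj C" "Z \<in> Obj C"
    "f \<in> Hom C W X" "g \<in> Hom C X Y" "h \<in> Hom C Y Z"
  then show "Comp C W X Z (Comp C X Y Z h g) f = Comp C W Y Z h (Comp C W X Y g f)"
    by (intro Hom_eqI[of W Z]) (simp_all add: Comp_Hom coord_Comp coord_in_carrier m_assoc)
qed (fact Id_mor_Hom Comp_Hom)+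

lemma arrow_one_iso:
  assumes "X \<in> Obj C" "Y \<in> Obj C"
  shows "arrow X Y \<one>\<^bsub>G\<^esub> \<in> isos C X Y"
proof -
  have inverse: "Comp C X Y X (arrow Y X \<one>\<^bsub>G\<^esub>) (arrow X Y \<one>\<^bsub>G\<^esub>) = Id_mor C X"
    if "X \<in> Obj C" "Y \<in> Obj C" for X Y
    using that by (intro Hom_eqI[of X X])
      (simp_all add: Comp_Hom Id_mor_Hom arrow_in_Hom coord_Comp coord_arrow coord_Id_mor)
  show ?thesis
    using assms unfolding isos_def
    by (auto simp: inverse arrow_in_Hom intro!: bexI[of _ "arrow Y X \<one>\<^bsub>G\<^esub>"])
qed

end

text \<open>
  Both functors collapse all objects to a single one and keep the coordinates of morphisms. The
  required natural isomorphisms are the arrows whose coordinate is the unit of \<open>G\<close>: in coordinates,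
  naturality says that the unit commutes with every element.
\<close>

theorem framed_categories_equivalent:
  assumes "framed_category G C carr\<^sub>C frame\<^sub>C act\<^sub>C" "framed_category G D carr\<^sub>D frame\<^sub>D act\<^sub>D"
    and "Obj C \<noteq> {}" "Obj D \<noteq> {}"
  shows "\<exists>F. is_equivalence C D F"
proof -
  interpret C: framed_category G C carr\<^sub>C frame\<^sub>C act\<^sub>C by fact
  interpret D: framed_category G D carr\<^sub>D frame\<^sub>D act\<^sub>D by fact
  obtain c d where c: "c \<in> Obj C" and d: "d \<in> Obj D"
    using assms(3,4) by auto
  define F where "F = \<lparr>omap = (\<lambda>_. d), amap = (\<lambda>X Y f. D.arrow d d (C.coord X Y f))\<rparr>"
  define F' where "F' = \<lparr>omap = (\<lambda>_. c), amap = (\<lambda>X Y f. C.arrow c c (D.coord X Y f))\<rparr>"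
  have F: "cat_functor C D F"
    by unfold_locales
      (auto simp: F_def d D.arrow_in_Hom D.Comp_Hom D.Id_mor_Hom D.coord_arrow D.coord_Comp
        D.coord_Id_mor C.coord_in_carrier C.coord_Id_mor C.coord_Comp intro!: D.Hom_eqI[OF d d])
  have F': "cat_functor D C F'"
    by unfold_locales
      (auto simp: F'_def c C.arrow_in_Hom C.Comp_Hom C.Id_mor_Hom C.coord_arrow C.coord_Comp
        C.coord_Id_mor D.coord_in_carrier D.coord_Id_mor D.coord_Comp intro!: C.Hom_eqI[OF c c])
  have "natural_isomorphism C C id_functor (comp_functor F' F) (\<lambda>X. C.arrow X c \<one>\<^bsub>G\<^esub>)"
  proof (intro natural_isomorphism.intro natural_isomorphism_axioms.intro)
    show "cat_functor C C id_functor"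
      by unfold_locales (simp_all add: id_functor_def)
    show "cat_functor C C (comp_functor F' F)"
      by (rule comp_functor_cat_functor[OF F F'])
    fix X assume X: "X \<in> Obj C"
    show "C.arrow X c \<one>\<^bsub>G\<^esub> \<in> isos C (omap id_functor X) (omap (comp_functor F' F) X)"
      using X c by (simp add: id_functor_def comp_functor_def F_def F'_def C.arrow_one_iso)
    fix Y f assume "Y \<in> Obj C" "f \<in> Hom C X Y"
    with X c d show "Comp C (omap id_functor X) (omap id_functor Y) (omap (comp_functor F' F) Y)
        (C.arrow Y c \<one>\<^bsub>G\<^esub>) (amap id_functor X Y f) =
      Comp C (omap id_functor X) (omap (comp_functor F' F) X) (omap (comp_functor F' F) Y)
        (amap (comp_functor F' F) X Y f) (C.arrow X c \<one>\<^bsub>G\<^esub>)"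
      by (intro C.Hom_eqI[of X c])
        (simp_all add: id_functor_def comp_functor_def F_def F'_def C.arrow_in_Hom C.Comp_Hom
          C.coord_arrow C.coord_Comp C.coord_in_carrier D.coord_arrow)
  qed
  moreover have "natural_isomorphism D D (comp_functor F F') id_functor (\<lambda>X. D.arrow d X \<one>\<^bsub>G\<^esub>)"
  proof (intro natural_isomorphism.intro natural_isomorphism_axioms.intro)
    show "cat_functor D D id_functor"
      by unfold_locales (simp_all add: id_functor_def)
    show "cat_functor D D (comp_functor F F')"
      by (rule comp_functor_cat_functor[OF F' F])
    fix X assume X: "X \<in> Obj D"
    show "D.arrow d X \<one>\<^bsub>G\<^esub> \<in> isos D (omap (comp_functor F F') X) (omap id_functor X)"
      using X d by (simp add: id_functor_def comp_functor_def F_def F'_def D.arrow_one_iso)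
    fix Y f assume "Y \<in> Obj D" "f \<in> Hom D X Y"
    with X c d show
      "Comp D (omap (comp_functor F F') X) (omap (comp_functor F F') Y) (omap id_functor Y)
        (D.arrow d Y \<one>\<^bsub>G\<^esub>) (amap (comp_functor F F') X Y f) =
      Comp D (omap (comp_functor F F') X) (omap id_functor X) (omap id_functor Y)
        (amap id_functor X Y f) (D.arrow d X \<one>\<^bsub>G\<^esub>)"
      by (intro D.Hom_eqI[of d Y])
        (simp_all add: id_functor_def comp_functor_def F_def F'_def D.arrow_in_Hom D.Comp_Hom
          D.coord_arrow D.coord_Comp D.coord_in_carrier C.coord_arrow)
  qed
  ultimately show ?thesis
    unfolding is_equivalence_def using F F' by blast
qed

section \<open>Cross products and cofactor matrices\<close>

lemmas complex3_simps =
  Finite_Cartesian_Product.vec_eq_iff forall_3 sum_3 cdot_def ccross_def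
  matrix_vector_mult_def matrix_matrix_mult_def

text \<open>
  The action on \<open>\<Lambda>\<^sup>2\<complex>\<^sup>3\<close>, which the cross product identifies with \<open>\<complex>\<^sup>3\<close>. It equals the inverse
  transpose for matrices of determinant 1, but is polynomial in the entries, so that the identities
  below are polynomial identities.
\<close>

definition cofactor_matrix :: "complex ^ 3 ^ 3 \<Rightarrow> complex ^ 3 ^ 3" where
  "cofactor_matrix M =
     vector [ccross (M $ 2) (M $ 3), ccross (M $ 3) (M $ 1), ccross (M $ 1) (M $ 2)]"

lemma ccross_matrix_vector: "ccross (M *v a) (M *v b) = cofactor_matrix M *v ccross a b"
  by (simp add: complex3_simps cofactor_matrix_def) (simp add: algebra_simps)

lemma ccross_cofactor:
  "ccross (cofactor_matrix M *v a) (cofactor_matrix M *v b) = Determinants.det M *s (M *v ccross a b)"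
  by (simp add: complex3_simps cofactor_matrix_def det_3) (simp add: algebra_simps)

lemma cdot_cofactor: "cdot (M *v a) (cofactor_matrix M *v b) = Determinants.det M * cdot a b"
  by (simp add: complex3_simps cofactor_matrix_def det_3) (simp add: algebra_simps)

lemma cofactor_mult: "cofactor_matrix (M ** N) = cofactor_matrix M ** cofactor_matrix N"
  by (simp add: complex3_simps cofactor_matrix_def) (simp add: algebra_simps)

lemma cofactor_one: "cofactor_matrix (Finite_Cartesian_Product.mat 1) = Finite_Cartesian_Product.mat 1"
  by (simp add: complex3_simps cofactor_matrix_def Finite_Cartesian_Product.mat_def)


section \<open>Algebra isomorphisms and square roots of -1\<close>

lemma algebra_isosI:
  assumes "bij_betw f (carrier A) (carrier B)"
    and "\<And>x y. \<lbrakk>x \<in> carrier A; y \<in> carrier A\<rbrakk> \<Longrightarrow> f (x \<oplus>\<^bsub>A\<^esub> y) = f x \<oplus>\<^bsub>B\<^esub> f y"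
    and "\<And>c x. x \<in> carrier A \<Longrightarrow> f (c \<odot>\<^bsub>A\<^esub> x) = c \<odot>\<^bsub>B\<^esub> f x"
    and "\<And>x y. \<lbrakk>x \<in> carrier A; y \<in> carrier A\<rbrakk> \<Longrightarrow> f (x \<otimes>\<^bsub>A\<^esub> y) = f x \<otimes>\<^bsub>B\<^esub> f y"
    and "f \<one>\<^bsub>A\<^esub> = \<one>\<^bsub>B\<^esub>"
  shows "f \<in> algebra_isos A B"
  using assms by (auto simp: algebra_isos_def module_hom_def bij_betw_def)

lemma algebra_isosD:
  assumes "f \<in> algebra_isos A B"
  shows "bij_betw f (carrier A) (carrier B)"
    and "x \<in> carrier A \<Longrightarrow> f x \<in> carrier B"
    and "\<lbrakk>x \<in> carrier A; y \<in> carrier A\<rbrakk> \<Longrightarrow> f (x \<oplus>\<^bsub>A\<^esub> y) = f x \<oplus>\<^bsub>B\<^esub> f y"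
    and "x \<in> carrier A \<Longrightarrow> f (c \<odot>\<^bsub>A\<^esub> x) = c \<odot>\<^bsub>B\<^esub> f x"
    and "\<lbrakk>x \<in> carrier A; y \<in> carrier A\<rbrakk> \<Longrightarrow> f (x \<otimes>\<^bsub>A\<^esub> y) = f x \<otimes>\<^bsub>B\<^esub> f y"
    and "f \<one>\<^bsub>A\<^esub> = \<one>\<^bsub>B\<^esub>"
  using assms by (auto simp: algebra_isos_def module_hom_def)

lemma algebra_isos_comp:
  assumes "f \<in> algebra_isos A B" "g \<in> algebra_isos B C"
  shows "g \<circ> f \<in> algebra_isos A C"
  by (rule algebra_isosI)
    (use bij_betw_trans algebra_isosD[OF assms(1)] algebra_isosD[OF assms(2)] in auto)

context complex_algebra
begin

lemma smult_in_carrier: "x \<in> carrier A \<Longrightarrow> c \<odot>\<^bsub>A\<^esub> x \<in> carrier A"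
  by simp

lemma minus_eq_smult: "x \<in> carrier A \<Longrightarrow> \<ominus>\<^bsub>A\<^esub> x = (- 1) \<odot>\<^bsub>A\<^esub> x"
  using smult_l_minus[of 1 x] smult_one[of x] by (simp add: class_ring_simps)

end

lemma algebra_isos_inv:
  assumes "complex_algebra A" "f \<in> algebra_isos A B"
  shows "inv_into (carrier A) f \<in> algebra_isos B A"
proof (rule algebra_isosI)
  interpret complex_algebra A by fact
  let ?g = "inv_into (carrier A) f"
  note f = algebra_isosD[OF assms(2)]
  show "bij_betw ?g (carrier B) (carrier A)"
    using f(1) by (rule bij_betw_inv_into)
  have g: "?g (f x) = x" if "x \<in> carrier A" for x
    using that f(1) by (simp add: bij_betw_inv_into_left)
  have surj: "\<exists>x \<in> carrier A. y = f x" if "y \<in> carrier B" for y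
    using that f(1) by (auto simp: bij_betw_def)
  show "?g (y \<oplus>\<^bsub>B\<^esub> z) = ?g y \<oplus>\<^bsub>A\<^esub> ?g z" if "y \<in> carrier B" "z \<in> carrier B" for y z
    using surj[OF that(1)] surj[OF that(2)] by (auto simp: g simp flip: f(3))
  show "?g (y \<otimes>\<^bsub>B\<^esub> z) = ?g y \<otimes>\<^bsub>A\<^esub> ?g z" if "y \<in> carrier B" "z \<in> carrier B" for y z
    using surj[OF that(1)] surj[OF that(2)] by (auto simp: g mult_closed simp flip: f(5))
  show "?g (c \<odot>\<^bsub>B\<^esub> y) = c \<odot>\<^bsub>A\<^esub> ?g y" if "y \<in> carrier B" for c y
    using surj[OF that] by (auto simp: g simp flip: f(4))
  show "?g \<one>\<^bsub>B\<^esub> = \<one>\<^bsub>A\<^esub>"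
    by (simp add: g unit_closed flip: f(6))
qed

text \<open>
  Stated by scalar multiples of the unit alone, the property is visibly invariant under isomorphisms.
\<close>

lemma nontrivial_root_iff:
  assumes "complex_algebra A"
  shows "nontrivial_root A j \<longleftrightarrow> j \<in> carrier A \<and> j \<otimes>\<^bsub>A\<^esub> j = (- 1) \<odot>\<^bsub>A\<^esub> \<one>\<^bsub>A\<^esub> \<and>
     (\<forall>c. c ^ 2 = - 1 \<longrightarrow> j \<noteq> c \<odot>\<^bsub>A\<^esub> \<one>\<^bsub>A\<^esub>)"
proof -
  interpret complex_algebra A by fact
  have "c ^ 2 = - 1 \<longleftrightarrow> c = \<i> \<or> c = - \<i>" for c :: complex
    using power2_eq_iff[of c \<i>] by simp
  then show ?thesis
    by (auto simp: nontrivial_root_def minus_eq_smult unit_closed)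
qed

lemma nontrivial_root_image:
  assumes "complex_algebra A" "complex_algebra B" "f \<in> algebra_isos A B" "nontrivial_root A j"
  shows "nontrivial_root B (f j)"
proof -
  interpret A: complex_algebra A by fact
  note f = algebra_isosD[OF assms(3)]
  note j = assms(4)[unfolded nontrivial_root_iff[OF assms(1)]]
  have "f j \<noteq> c \<odot>\<^bsub>B\<^esub> \<one>\<^bsub>B\<^esub>" if "c ^ 2 = - 1" for c
  proof
    assume "f j = c \<odot>\<^bsub>B\<^esub> \<one>\<^bsub>B\<^esub>"
    then have "f j = f (c \<odot>\<^bsub>A\<^esub> \<one>\<^bsub>A\<^esub>)"
      by (simp add: f(4) f(6) A.unit_closed)
    moreover have "c \<odot>\<^bsub>A\<^esub> \<one>\<^bsub>A\<^esub> \<in> carrier A"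
      by (simp add: A.unit_closed A.smult_in_carrier)
    ultimately have "j = c \<odot>\<^bsub>A\<^esub> \<one>\<^bsub>A\<^esub>"
      using f(1) j by (auto simp: bij_betw_def dest: inj_onD)
    with j that show False by blast
  qed
  with j show ?thesis
    by (simp add: nontrivial_root_iff[OF assms(2)] f(2) A.unit_closed flip: f(4,5,6))
qed

lemma algebra_isos_cong:
  assumes "complex_algebra A" "f \<in> algebra_isos A B" "\<And>x. x \<in> carrier A \<Longrightarrow> g x = f x"
  shows "g \<in> algebra_isos A B"
proof -
  interpret complex_algebra A by fact
  note f = algebra_isosD[OF assms(2)]
  show ?thesis
    by (rule algebra_isosI)
      (simp_all add: assms(3) f mult_closed unit_closed smult_in_carrier bij_betw_cong[OF assms(3)])
qed

section \<open>Transfer of structure along a bijection\<close>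

text \<open>
  The axioms carry over because the bijection determines the operations of \<open>W\<close>. The condition on
  zero is needed because nothing else ties the zero of \<open>W\<close> to its addition.
\<close>

lemma vectorspace_transfer:
  fixes V :: "(complex, 'a, 'r) module_scheme" and W :: "(complex, 'b, 's) module_scheme"
  assumes V: "vectorspace class_ring V" and h: "h \<in> module_hom class_ring V W"
    and bij: "bij_betw h (carrier V) (carrier W)" and zero: "h \<zero>\<^bsub>V\<^esub> = \<zero>\<^bsub>W\<^esub>"
  shows "vectorspace class_ring W"
    and "vectorspace.fin_dim class_ring V \<Longrightarrow> vectorspace.fin_dim class_ring W"
    and "vectorspace.fin_dim class_ring V \<Longrightarrow>
      vectorspace.dim class_ring W = vectorspace.dim class_ring V"
proof -
  interpret V: vectorspace class_ring V by fact
  have hom: "h (x \<oplus>\<^bsub>V\<^esub> y) = h x \<oplus>\<^bsub>W\<^esub> h y" "h (c \<odot>\<^bsub>V\<^esub> x) = c \<odot>\<^bsub>W\<^esub> h x"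
    if "x \<in> carrier V" "y \<in> carrier V" for x y c
    using h that by (simp_all add: module_hom_def)
  have W: "carrier W = h ` carrier V"
    using bij by (simp add: bij_betw_def)
  have smult: "c \<odot>\<^bsub>V\<^esub> x \<in> carrier V" "(c + d) \<odot>\<^bsub>V\<^esub> x = c \<odot>\<^bsub>V\<^esub> x \<oplus>\<^bsub>V\<^esub> d \<odot>\<^bsub>V\<^esub> x"
    "(c * d) \<odot>\<^bsub>V\<^esub> x = c \<odot>\<^bsub>V\<^esub> (d \<odot>\<^bsub>V\<^esub> x)" "1 \<odot>\<^bsub>V\<^esub> x = x"
    if "x \<in> carrier V" for c d x
    using that V.smult_closed[of c x] V.smult_l_distr[of c d x] V.smult_assoc1[of c d x]
      V.smult_one[of x] by simp_all
  have "abelian_group W"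
  proof (rule abelian_groupI)
    fix x assume "x \<in> carrier W"
    then obtain x' where x': "x' \<in> carrier V" "x = h x'"
      by (auto simp: W)
    then show "\<exists>y \<in> carrier W. y \<oplus>\<^bsub>W\<^esub> x = \<zero>\<^bsub>W\<^esub>"
      by (intro bexI[of _ "h (\<ominus>\<^bsub>V\<^esub> x')"]) (simp_all add: W V.l_neg flip: hom(1) zero)
  qed (auto simp: W V.a_ac simp flip: hom(1) zero)
  then have "module class_ring W"
    by (intro moduleI class_cring.is_cring)
      (auto simp: W smult V.smult_r_distr simp flip: hom)
  then show vs: "vectorspace class_ring W"
    by (simp add: vectorspace_def class_field)
  interpret h: linear_map class_ring V W h
    using V vs h by (simp add: linear_map_def mod_hom_def vectorspace_def mod_hom_axioms_def)
  assume fin: "V.fin_dim"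
  show "vectorspace.fin_dim class_ring W"
    using h.surj_fin_dim[OF fin] W by simp
  show "vectorspace.dim class_ring W = V.dim"
    using h.dim_eq[OF fin] bij by (simp add: bij_betw_def)
qed

lemma complex_algebra_transfer:
  assumes A: "complex_algebra A" and h: "h \<in> algebra_isos A B" and zero: "h \<zero>\<^bsub>A\<^esub> = \<zero>\<^bsub>B\<^esub>"
  shows "complex_algebra B"
proof -
  interpret A: complex_algebra A by fact
  note hom = algebra_isosD[OF h]
  have mod: "h \<in> module_hom class_ring A B"
    using h by (simp add: algebra_isos_def)
  note transfer = vectorspace_transfer[OF A.vectorspace_axioms mod hom(1) zero]
  have B: "carrier B = h ` carrier A"
    using hom(1) by (simp add: bij_betw_def)
  show ?thesis
    by (intro complex_algebra.intro complex_algebra_axioms.intro transfer A.finite_dimensional)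
      (auto simp: B A.mult_closed A.mult_add_left A.mult_add_right A.mult_smult_left
        A.mult_smult_right A.unit_closed A.unit_left A.unit_right A.smult_in_carrier
        simp flip: hom(3-6))
qed

lemma bioctonions_simps [simp]:
  "carrier bioctonions = UNIV"
  "x \<otimes>\<^bsub>bioctonions\<^esub> y = bioct_mult x y"
  "\<one>\<^bsub>bioctonions\<^esub> = (1, 0, 0, 1)"
  "\<zero>\<^bsub>bioctonions\<^esub> = 0"
  "x \<oplus>\<^bsub>bioctonions\<^esub> y = x + y"
  "c \<odot>\<^bsub>bioctonions\<^esub> x = bioct_smult c x"
  by (simp_all add: bioctonions_def)

text \<open>
  Comparing with the coordinate spaces \<^term>\<open>carrier_vec n\<close>, whose dimension is known, provides the
  finiteness of dimension for the bioctonions and the dimension 3 for the model volume space.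
\<close>

lemma bij_betw_carrier_vec_3:
  "bij_betw (\<lambda>v. vector [vec_index v 0, vec_index v 1, vec_index v 2] :: complex ^ 3)
     (carrier_vec 3) UNIV"
proof (rule bij_betw_byWitness[where f' = "\<lambda>a. vec_of_list [a $ 1, a $ 2, a $ 3]"])
  show "\<forall>v \<in> carrier_vec 3. vec_of_list
      [(vector [vec_index v 0, vec_index v 1, vec_index v 2] :: complex ^ 3) $ 1,
       (vector [vec_index v 0, vec_index v 1, vec_index v 2] :: complex ^ 3) $ 2,
       (vector [vec_index v 0, vec_index v 1, vec_index v 2] :: complex ^ 3) $ 3] = v"
  proof
    fix v :: "complex Matrix.vec" assume v: "v \<in> carrier_vec 3"
    have "vec_index (vec_of_list [vec_index v 0, vec_index v 1, vec_index v 2]) i = vec_index v i"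
      if "i < 3" for i
    proof -
      have "i = 0 \<or> i = 1 \<or> i = 2" using that by presburger
      then show ?thesis by (elim disjE) (simp_all add: vec_of_list_index del: vec_of_list_Cons)
    qed
    with v show "vec_of_list
      [(vector [vec_index v 0, vec_index v 1, vec_index v 2] :: complex ^ 3) $ 1,
       (vector [vec_index v 0, vec_index v 1, vec_index v 2] :: complex ^ 3) $ 2,
       (vector [vec_index v 0, vec_index v 1, vec_index v 2] :: complex ^ 3) $ 3] = v"
      by (intro eq_vecI) (auto simp del: vec_of_list_Cons)
  qed
  show "\<forall>a \<in> UNIV. vector [vec_index (vec_of_list [a $ 1, a $ 2, a $ 3]) 0,
      vec_index (vec_of_list [a $ 1, a $ 2, a $ 3]) 1,
      vec_index (vec_of_list [a $ 1, a $ 2, a $ 3]) 2] = (a :: complex ^ 3)"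
    unfolding vec_of_list_index by (simp add: Finite_Cartesian_Product.vec_eq_iff forall_3)
  show "(\<lambda>a :: complex ^ 3. vec_of_list [a $ 1, a $ 2, a $ 3]) ` UNIV \<subseteq> carrier_vec 3"
    by (rule image_subsetI, rule carrier_vecI) (simp del: vec_of_list_Cons)
qed simp

lemma complex_algebra_bioctonions: "complex_algebra bioctonions"
proof -
  define h :: "complex Matrix.vec \<Rightarrow> bioctonion" where
    "h v = (vec_index v 0, vector [vec_index v 1, vec_index v 2, vec_index v 3],
      vector [vec_index v 4, vec_index v 5, vec_index v 6], vec_index v 7)" for v
  have bij: "bij_betw h (carrier_vec 8) UNIV"
  proof (rule bij_betw_byWitness[where
        f' = "\<lambda>(\<alpha>, a, a', \<alpha>'). vec_of_list [\<alpha>, a $ 1, a $ 2, a $ 3, a' $ 1, a' $ 2, a' $ 3, \<alpha>']"])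
    show "\<forall>v \<in> carrier_vec 8. (case h v of (\<alpha>, a, a', \<alpha>') \<Rightarrow>
        vec_of_list [\<alpha>, a $ 1, a $ 2, a $ 3, a' $ 1, a' $ 2, a' $ 3, \<alpha>']) = v"
    proof
      fix v :: "complex Matrix.vec" assume v: "v \<in> carrier_vec 8"
      have "vec_index (vec_of_list [vec_index v 0, vec_index v 1, vec_index v 2, vec_index v 3,
          vec_index v 4, vec_index v 5, vec_index v 6, vec_index v 7]) i = vec_index v i"
        if "i < 8" for i
      proof -
        have "i = 0 \<or> i = 1 \<or> i = 2 \<or> i = 3 \<or> i = 4 \<or> i = 5 \<or> i = 6 \<or> i = 7"
          using that by presburger
        then show ?thesis by (elim disjE) (simp_all add: vec_of_list_index del: vec_of_list_Cons)
      qed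
      with v show "(case h v of (\<alpha>, a, a', \<alpha>') \<Rightarrow>
          vec_of_list [\<alpha>, a $ 1, a $ 2, a $ 3, a' $ 1, a' $ 2, a' $ 3, \<alpha>']) = v"
        by (intro eq_vecI) (auto simp: h_def simp del: vec_of_list_Cons)
    qed
    show "\<forall>x \<in> UNIV. h (case x of (\<alpha>, a, a', \<alpha>') \<Rightarrow>
        vec_of_list [\<alpha>, a $ 1, a $ 2, a $ 3, a' $ 1, a' $ 2, a' $ 3, \<alpha>']) = x"
      by (simp add: h_def vec_of_list_index Finite_Cartesian_Product.vec_eq_iff forall_3
        del: vec_of_list_Cons split: prod.split)
    show "(\<lambda>(\<alpha>, a :: complex ^ 3, a' :: complex ^ 3, \<alpha>').
        vec_of_list [\<alpha>, a $ 1, a $ 2, a $ 3, a' $ 1, a' $ 2, a' $ 3, \<alpha>']) ` UNIV \<subseteq> carrier_vec 8"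
      by (rule image_subsetI, rule carrier_vecI) (simp del: vec_of_list_Cons split: prod.split)
  qed simp
  have h: "h \<in> module_hom class_ring (module_vec TYPE(complex) 8) bioctonions"
    by (auto simp: module_hom_def module_vec_simps h_def complex3_simps)
  have zero: "h \<zero>\<^bsub>module_vec TYPE(complex) 8\<^esub> = \<zero>\<^bsub>bioctonions\<^esub>"
    by (simp add: module_vec_simps h_def zero_prod_def complex3_simps)
  have bij': "bij_betw h (carrier (module_vec TYPE(complex) 8)) (carrier bioctonions)"
    using bij by (simp add: module_vec_simps)
  note transfer = vectorspace_transfer[OF vec_vs h bij' zero]
  have fin_dim: "vectorspace.fin_dim class_ring (module_vec TYPE(complex) 8)"
    by (rule vec_space.fin_dim)
  show ?thesis
  proof (intro complex_algebra.intro complex_algebra_axioms.intro transfer fin_dim)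
    fix x y z :: bioctonion and c
    show "(x \<oplus>\<^bsub>bioctonions\<^esub> y) \<otimes>\<^bsub>bioctonions\<^esub> z =
        x \<otimes>\<^bsub>bioctonions\<^esub> z \<oplus>\<^bsub>bioctonions\<^esub> y \<otimes>\<^bsub>bioctonions\<^esub> z"
      and "x \<otimes>\<^bsub>bioctonions\<^esub> (y \<oplus>\<^bsub>bioctonions\<^esub> z) =
        x \<otimes>\<^bsub>bioctonions\<^esub> y \<oplus>\<^bsub>bioctonions\<^esub> x \<otimes>\<^bsub>bioctonions\<^esub> z"
      by (cases x; cases y; cases z; simp add: complex3_simps; simp add: algebra_simps)+
    show "(c \<odot>\<^bsub>bioctonions\<^esub> x) \<otimes>\<^bsub>bioctonions\<^esub> y =
        c \<odot>\<^bsub>bioctonions\<^esub> (x \<otimes>\<^bsub>bioctonions\<^esub> y)"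
      and "x \<otimes>\<^bsub>bioctonions\<^esub> (c \<odot>\<^bsub>bioctonions\<^esub> y) =
        c \<odot>\<^bsub>bioctonions\<^esub> (x \<otimes>\<^bsub>bioctonions\<^esub> y)"
      by (cases x; cases y; simp add: complex3_simps; simp add: algebra_simps)+
    show "\<one>\<^bsub>bioctonions\<^esub> \<otimes>\<^bsub>bioctonions\<^esub> x = x"
      and "x \<otimes>\<^bsub>bioctonions\<^esub> \<one>\<^bsub>bioctonions\<^esub> = x"
      by (cases x; simp add: complex3_simps)+
  qed simp_all
qed

section \<open>Transitivity on nontrivial square roots of -1\<close>

text \<open>
  The exponential of a nilpotent derivation of the bioctonions, which does not preserve the diagonal.
  It is quadratic in \<open>v\<close>, and \<open>v \<mapsto> - v\<close> inverts it. Such maps move the diagonal entries of a square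
  root of \<open>-1\<close>.
\<close>

definition transvection :: "complex ^ 3 \<Rightarrow> bioctonion \<Rightarrow> bioctonion" where
  "transvection v = (\<lambda>(\<alpha>, a, a', \<alpha>').
     (\<alpha> + cdot v a', a + (\<alpha>' - \<alpha>) *s v - cdot v a' *s v, a' - ccross v a, \<alpha>' - cdot v a'))"

lemma transvection_mult:
  "transvection v (bioct_mult x y) = bioct_mult (transvection v x) (transvection v y)"
  by (cases x; cases y)
    (simp add: transvection_def complex3_simps, simp add: algebra_simps)

lemma transvection_inverse:
  "transvection (- v) (transvection v x) = x"
  by (cases x)
    (simp add: transvection_def complex3_simps, simp add: algebra_simps)

text \<open>
  Exchanging the two rows and the two columns. The signs compensate for the opposite signs of the
  cross products in the two off-diagonal entries of the product.
\<close>

definition swap :: "bioctonion \<Rightarrow> bioctonion" where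
  "swap = (\<lambda>(\<alpha>, a, a', \<alpha>'). (\<alpha>', - a', - a, \<alpha>))"

lemma swap_mult: "swap (bioct_mult x y) = bioct_mult (swap x) (swap y)"
  by (cases x; cases y) (simp add: swap_def complex3_simps algebra_simps)

definition standard_root :: bioctonion where
  "standard_root = (\<i>, 0, 0, - \<i>)"

lemma transvection_automorphism: "transvection v \<in> algebra_isos bioctonions bioctonions"
proof (rule algebra_isosI)
  have "transvection v (transvection (- v) x) = x" for x
    using transvection_inverse[of "- v"] by simp
  then have "bij (transvection v)"
    by (intro o_bij[of "transvection (- v)"]) (auto simp: transvection_inverse fun_eq_iff)
  then show "bij_betw (transvection v) (carrier bioctonions) (carrier bioctonions)"
    by simp
  show "transvection v (x \<oplus>\<^bsub>bioctonions\<^esub> y) =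
      transvection v x \<oplus>\<^bsub>bioctonions\<^esub> transvection v y" for x y
    by (cases x; cases y) (simp add: transvection_def complex3_simps, simp add: algebra_simps)
  show "transvection v (c \<odot>\<^bsub>bioctonions\<^esub> x) = c \<odot>\<^bsub>bioctonions\<^esub> transvection v x" for c x
    by (cases x) (simp add: transvection_def complex3_simps, simp add: algebra_simps)
  show "transvection v \<one>\<^bsub>bioctonions\<^esub> = \<one>\<^bsub>bioctonions\<^esub>"
    by (simp add: transvection_def complex3_simps)
qed (simp add: transvection_mult)

lemma swap_automorphism: "swap \<in> algebra_isos bioctonions bioctonions"
proof (rule algebra_isosI)
  have "bij swap"
    by (rule o_bij[of swap]) (auto simp: swap_def)
  then show "bij_betw swap (carrier bioctonions) (carrier bioctonions)"
    by simp
  show "swap (x \<oplus>\<^bsub>bioctonions\<^esub> y) = swap x \<oplus>\<^bsub>bioctonions\<^esub> swap y" for x y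
    by (cases x; cases y) (simp add: swap_def)
  show "swap (c \<odot>\<^bsub>bioctonions\<^esub> x) = c \<odot>\<^bsub>bioctonions\<^esub> swap x" for c x
    by (cases x) (simp add: swap_def complex3_simps)
  show "swap \<one>\<^bsub>bioctonions\<^esub> = \<one>\<^bsub>bioctonions\<^esub>"
    by (simp add: swap_def)
qed (simp add: swap_mult)

text \<open>
  The off-diagonal entries of the square are those of the root multiplied by its trace. If the trace
  were not 0, the root would be diagonal with equal entries, that is, a multiple of the unit.
\<close>

lemma root_components:
  assumes sq: "bioct_mult (\<alpha>, a, a', \<alpha>') (\<alpha>, a, a', \<alpha>') = (- 1, 0, 0, - 1)"
    and nontrivial: "\<And>c. c ^ 2 = - 1 \<Longrightarrow> (\<alpha>, a, a', \<alpha>') \<noteq> (c, 0, 0, c)"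
  shows "\<alpha>' = - \<alpha>" "\<alpha> ^ 2 + cdot a a' = - 1"
proof -
  have cross: "ccross b b = 0" for b
    by (simp add: complex3_simps)
  have 1: "\<alpha> ^ 2 + cdot a a' = - 1" "\<alpha>' ^ 2 + cdot a a' = - 1"
    and 2: "(\<alpha> + \<alpha>') *s a = 0" "(\<alpha> + \<alpha>') *s a' = 0"
    using sq by (simp_all add: cross power2_eq_square vector_sadd_rdistrib cdot_def mult.commute
        add.commute)
  show "\<alpha> ^ 2 + cdot a a' = - 1" by fact
  show "\<alpha>' = - \<alpha>"
  proof (rule ccontr)
    assume "\<alpha>' \<noteq> - \<alpha>"
    then have ne: "\<alpha> + \<alpha>' \<noteq> 0"
      by (auto simp: add_eq_0_iff)
    with 2 have "a = 0" "a' = 0"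
      by simp_all
    moreover from 1 have "\<alpha>' ^ 2 = \<alpha> ^ 2"
      by (metis add_right_cancel)
    with ne have "\<alpha>' = \<alpha>"
      by (auto simp: power2_eq_iff)
    ultimately show False
      using nontrivial[of \<alpha>] 1 by (simp add: cdot_def)
  qed
qed

definition in_standard_orbit :: "bioctonion \<Rightarrow> bool" where
  "in_standard_orbit j \<longleftrightarrow> (\<exists>f \<in> algebra_isos bioctonions bioctonions. f j = standard_root)"

lemma in_standard_orbit_image:
  "\<lbrakk>f \<in> algebra_isos bioctonions bioctonions; in_standard_orbit (f j)\<rbrakk> \<Longrightarrow> in_standard_orbit j"
  unfolding in_standard_orbit_def by (metis algebra_isos_comp comp_apply)

lemmas in_standard_orbit_transvection = in_standard_orbit_image[OF transvection_automorphism]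
lemmas in_standard_orbit_swap = in_standard_orbit_image[OF swap_automorphism]

text \<open>
  Since a transvection cancels an upper right entry and \<open>swap\<close> exchanges the corners, the lower left
  entry can be cancelled by a transvection between two swaps.
\<close>

lemma in_standard_orbit_lower: "in_standard_orbit (\<i>, 0, a', - \<i>)"
proof -
  have "in_standard_orbit (- \<i>, 0, 0, \<i>)"
    unfolding in_standard_orbit_def
    by (rule bexI[OF _ swap_automorphism]) (simp add: swap_def standard_root_def)
  also have "(- \<i>, 0, 0, \<i>) = transvection ((- \<i> / 2) *s a') (- \<i>, - a', 0, \<i>)"
    by (simp add: transvection_def complex3_simps)
  finally have "in_standard_orbit (- \<i>, - a', 0, \<i>)"
    by (rule in_standard_orbit_transvection)
  then show ?thesis
    using in_standard_orbit_swap[of "(\<i>, 0, a', - \<i>)"] by (simp add: swap_def)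
qed

text \<open>
  The transvection along a multiple of \<open>a\<close> cancels \<open>a\<close>; by orthogonality it changes neither the
  diagonal nor \<open>a'\<close>.
\<close>

lemma in_standard_orbit_orthogonal:
  assumes "cdot a a' = 0"
  shows "in_standard_orbit (\<i>, a, a', - \<i>)"
proof (rule in_standard_orbit_transvection)
  have "cdot ((- \<i> / 2) *s a) a' = (- \<i> / 2) * cdot a a'"
    by (simp add: cdot_def sum_3 algebra_simps)
  then have "transvection ((- \<i> / 2) *s a) (\<i>, a, a', - \<i>) = (\<i>, 0, a', - \<i>)"
    using assms by (simp add: transvection_def) (simp add: complex3_simps)
  then show "in_standard_orbit (transvection ((- \<i> / 2) *s a) (\<i>, a, a', - \<i>))"
    by (simp add: in_standard_orbit_lower)
qed

lemma exists_cdot_eq: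
  assumes "b \<noteq> 0"
  obtains v where "cdot v b = c"
proof -
  from assms obtain i where "b $ i \<noteq> 0"
    by (auto simp: Finite_Cartesian_Product.vec_eq_iff)
  moreover have "cdot (axis i d) b = (\<Sum>k \<in> UNIV. if k = i then d * b $ i else 0)" for d
    unfolding cdot_def by (rule sum.cong) (auto simp: axis_def)
  ultimately have "cdot (axis i (c / b $ i)) b = c"
    by simp
  then show ?thesis
    by (rule that)
qed

text \<open>
  It is enough to make the upper left entry equal to \<open>\<i>\<close>, because then the norm equation makes the
  off-diagonal entries orthogonal. If \<open>a'\<close> is not 0, a transvection can add any number to that
  entry. Otherwise the entry is \<open>\<plusminus>\<i>\<close> already, and \<open>swap\<close> corrects the sign.
\<close>

lemma root_in_standard_orbit:
  assumes sq: "bioct_mult j j = (- 1, 0, 0, - 1)"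
    and nontrivial: "\<And>c. c ^ 2 = - 1 \<Longrightarrow> j \<noteq> (c, 0, 0, c)"
  shows "in_standard_orbit j"
proof -
  obtain \<alpha> a a' where j: "j = (\<alpha>, a, a', - \<alpha>)" and norm: "\<alpha> ^ 2 + cdot a a' = - 1"
    using root_components assms by (cases j) metis
  show ?thesis
  proof (cases "a' = 0")
    case True
    then have "(\<alpha> - \<i>) * (\<alpha> + \<i>) = 0"
      using norm by (simp add: cdot_def power2_eq_square algebra_simps)
    then consider "\<alpha> = \<i>" | "\<alpha> = - \<i>"
      by (auto simp: eq_neg_iff_add_eq_0)
    then show ?thesis
    proof cases
      case 1
      with True show ?thesis
        by (simp add: j in_standard_orbit_orthogonal cdot_def)
    next
      case 2
      with True show ?thesis
        using in_standard_orbit_swap[of j] by (simp add: j swap_def in_standard_orbit_lower)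
    qed
  next
    case False
    then obtain v where v: "cdot v a' = \<i> - \<alpha>"
      by (rule exists_cdot_eq)
    obtain b b' where b: "transvection v j = (\<i>, b, b', - \<i>)"
      by (simp add: j transvection_def v)
    have "bioct_mult (transvection v j) (transvection v j) = (- 1, 0, 0, - 1)"
      unfolding transvection_mult[symmetric] sq
      by (simp add: transvection_def complex3_simps)
    then have "cdot b b' = 0"
      by (simp add: b)
    then show ?thesis
      using in_standard_orbit_transvection[of v j] by (simp add: b in_standard_orbit_orthogonal)
  qed
qed

section \<open>Automorphisms fixing the standard root\<close>

fun unimodular_action :: "complex ^ 3 ^ 3 \<Rightarrow> bioctonion \<Rightarrow> bioctonion" where
  "unimodular_action M (\<alpha>, a, a', \<alpha>') = (\<alpha>, M *v a, cofactor_matrix M *v a', \<alpha>')"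

lemma cdot_commute: "cdot a b = cdot b a"
  by (simp add: cdot_def mult.commute)

lemma cdot_cofactor_left:
  "cdot (cofactor_matrix M *v b) (M *v a) = Determinants.det M * cdot b a"
  by (metis cdot_cofactor cdot_commute)

lemma unimodular_action_mult:
  "unimodular_action (M ** N) x = unimodular_action M (unimodular_action N x)"
  by (cases x) (simp add: cofactor_mult matrix_vector_mul_assoc)

lemma unimodular_action_one: "unimodular_action (Finite_Cartesian_Product.mat 1) x = x"
  by (cases x) (simp add: cofactor_one)

lemma unimodular_action_automorphism:
  assumes "Determinants.det M = 1"
  shows "unimodular_action M \<in> algebra_isos bioctonions bioctonions"
proof (rule algebra_isosI)
  obtain N where N: "M ** N = Finite_Cartesian_Product.mat 1" "N ** M = Finite_Cartesian_Product.mat 1"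
    using assms invertible_det_nz[of M] by (auto simp: invertible_def)
  have "bij (unimodular_action M)"
    by (rule o_bij[of "unimodular_action N"])
      (auto simp: fun_eq_iff unimodular_action_one N simp flip: unimodular_action_mult)
  then show "bij_betw (unimodular_action M) (carrier bioctonions) (carrier bioctonions)"
    by simp
  show "unimodular_action M (x \<otimes>\<^bsub>bioctonions\<^esub> y) =
      unimodular_action M x \<otimes>\<^bsub>bioctonions\<^esub> unimodular_action M y" for x y
    by (cases x; cases y)
      (simp add: assms ccross_matrix_vector[of M] ccross_cofactor
        cdot_cofactor cdot_cofactor_left matrix_vector_right_distrib matrix_vector_mult_diff_distrib
        vector_scalar_commute)
  show "unimodular_action M (x \<oplus>\<^bsub>bioctonions\<^esub> y) =
      unimodular_action M x \<oplus>\<^bsub>bioctonions\<^esub> unimodular_action M y" for x y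
    by (cases x; cases y) (simp add: matrix_vector_right_distrib)
  show "unimodular_action M (c \<odot>\<^bsub>bioctonions\<^esub> x) =
      c \<odot>\<^bsub>bioctonions\<^esub> unimodular_action M x" for c x
    by (cases x) (simp add: vector_scalar_commute)
qed simp

text \<open>
  The idempotents \<open>e = diag(1, 0)\<close> and \<open>e' = diag(0, 1)\<close> are linear combinations of the unit and
  the standard root, so they are fixed as well. The upper right corner consists of the \<open>x\<close> with
  \<open>e x = x = x e'\<close>, and similarly for the lower left one, so the automorphism restricts to linear
  maps \<open>p\<close> and \<open>q\<close> of the corners. The product of two upper elements is the cross product in the
  lower corner, which forces \<open>q\<close> to be the cofactor matrix of \<open>p\<close>. The product of an upper and a lower
  element is their dot product, which forces the determinant to be 1.
\<close>

lemma automorphism_fixing_standard_root: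
  assumes g: "g \<in> algebra_isos bioctonions bioctonions" and root: "g standard_root = standard_root"
  shows "\<exists>M. Determinants.det M = 1 \<and> g = unimodular_action M"
proof -
  note hom = algebra_isosD[OF g, simplified]
  define e e' :: bioctonion where "e = (1, 0, 0, 0)" and "e' = (0, 0, 0, 1)"
  have "g e = bioct_smult (1 / 2) (g (1, 0, 0, 1) + bioct_smult (- \<i>) (g standard_root))"
    by (simp add: e_def standard_root_def flip: hom(3,4))
  then have ge: "g e = e"
    by (simp add: root hom(6)) (simp add: e_def standard_root_def)
  have "g e' = bioct_smult (1 / 2) (g (1, 0, 0, 1) + bioct_smult \<i> (g standard_root))"
    by (simp add: e'_def standard_root_def flip: hom(3,4))
  then have ge': "g e' = e'"
    by (simp add: root hom(6)) (simp add: e'_def standard_root_def)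
  have cross0: "ccross 0 b = 0" "ccross b 0 = 0" and dot0: "cdot 0 b = 0" "cdot b 0 = 0" for b
    by (simp_all add: complex3_simps)
  have "\<exists>b. g (0, a, 0, 0) = (0, b, 0, 0)" for a
  proof -
    have "bioct_mult e (g (0, a, 0, 0)) = g (0, a, 0, 0)"
      by (subst ge[symmetric]) (simp add: e_def cross0 dot0 flip: hom(5))
    moreover have "bioct_mult (g (0, a, 0, 0)) e' = g (0, a, 0, 0)"
      by (subst ge'[symmetric]) (simp add: e'_def cross0 dot0 flip: hom(5))
    ultimately show ?thesis
      by (cases "g (0, a, 0, 0)") (auto simp: e_def e'_def cross0 dot0)
  qed
  then obtain p where p: "g (0, a, 0, 0) = (0, p a, 0, 0)" for a
    by metis
  have "\<exists>b. g (0, 0, a, 0) = (0, 0, b, 0)" for a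
  proof -
    have "bioct_mult e' (g (0, 0, a, 0)) = g (0, 0, a, 0)"
      by (subst ge'[symmetric]) (simp add: e'_def cross0 dot0 flip: hom(5))
    moreover have "bioct_mult (g (0, 0, a, 0)) e = g (0, 0, a, 0)"
      by (subst ge[symmetric]) (simp add: e_def cross0 dot0 flip: hom(5))
    ultimately show ?thesis
      by (cases "g (0, 0, a, 0)") (auto simp: e_def e'_def cross0 dot0)
  qed
  then obtain q where q: "g (0, 0, a, 0) = (0, 0, q a, 0)" for a
    by metis
  have p_add: "p (a + b) = p a + p b" and q_add: "q (a + b) = q a + q b" for a b
    using hom(3)[of "(0, a, 0, 0)" "(0, b, 0, 0)"] hom(3)[of "(0, 0, a, 0)" "(0, 0, b, 0)"]
    by (simp_all add: p q)
  have p_smult: "p (c *s a) = c *s p a" and q_smult: "q (c *s a) = c *s q a" for c a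
    using hom(4)[of c "(0, a, 0, 0)"] hom(4)[of c "(0, 0, a, 0)"]
    by (simp_all add: p q)
  have q_cross: "q (ccross a b) = ccross (p a) (p b)" for a b
    using hom(5)[of "(0, a, 0, 0)" "(0, b, 0, 0)"] by (simp add: p q cross0 dot0)
  have pq_dot: "cdot (p a) (q b) = cdot a b" for a b
  proof -
    have "g (cdot a b, 0, 0, 0) = bioct_smult (cdot a b) (g e)"
      by (simp add: e_def flip: hom(4))
    then show ?thesis
      using hom(5)[of "(0, a, 0, 0)" "(0, 0, b, 0)"] 
      by (simp add: p q cross0 dot0 ge) (simp add: e_def)
  qed
  define M where "M = matrix p"
  have "Vector_Spaces.linear (*s) (*s) p"
    by unfold_locales (simp_all add: p_add p_smult)
  then have pM: "p a = M *v a" for a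
    by (simp add: M_def matrix_works)
  have qM: "q a = cofactor_matrix M *v a" for a
  proof -
    have "q (ccross b c) = cofactor_matrix M *v ccross b c" for b c
      by (simp add: q_cross pM ccross_matrix_vector)
    \<comment> \<open>Cross products span, so the linear maps agree: \<open>s r\<close> expands \<open>a\<close> in the cross products of the
      standard basis after applying \<open>r\<close> to them.\<close>
    moreover define s where "s = (\<lambda>r :: complex ^ 3 \<Rightarrow> complex ^ 3.
      a $ 1 *s r (ccross (axis 2 1) (axis 3 1)) + a $ 2 *s r (ccross (axis 3 1) (axis 1 1)) +
      a $ 3 *s r (ccross (axis 1 1) (axis 2 1)))"
    ultimately have "s q = s ((*v) (cofactor_matrix M))"
      by simp
    moreover have "s (\<lambda>b. b) = a"
      by (simp add: s_def complex3_simps axis_def)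
    moreover have "s q = q (s (\<lambda>b. b))"
      by (simp add: s_def q_add q_smult)
    moreover have "s ((*v) (cofactor_matrix M)) = cofactor_matrix M *v s (\<lambda>b. b)"
      by (simp add: s_def matrix_vector_right_distrib vector_scalar_commute)
    ultimately show ?thesis
      by simp
  qed
  have "Determinants.det M * cdot (axis 1 1) (axis 1 1) = cdot (axis 1 1) (axis 1 1)"
    using pq_dot[of "axis 1 1" "axis 1 1"] by (simp add: pM qM cdot_cofactor)
  then have "Determinants.det M = 1"
    by (simp add: cdot_def axis_def sum_3)
  moreover have "g x = unimodular_action M x" for x
  proof -
    obtain \<alpha> a a' \<alpha>' where x: "x = (\<alpha>, a, a', \<alpha>')"
      by (cases x)
    have "x = bioct_smult \<alpha> e + (0, a, 0, 0) + (0, 0, a', 0) + bioct_smult \<alpha>' e'"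
      by (simp add: x e_def e'_def)
    then have "g x = bioct_smult \<alpha> e + (0, p a, 0, 0) + (0, 0, q a', 0) + bioct_smult \<alpha>' e'"
      by (simp add: hom(3) hom(4) p q ge ge')
    then show ?thesis
      by (simp add: x e_def e'_def pM qM)
  qed
  ultimately show ?thesis
    by blast
qed

section \<open>Volume spaces are framed by the special linear group\<close>

definition special_linear :: "(complex ^ 3 ^ 3) monoid" where
  "special_linear =
     \<lparr>carrier = {M. Determinants.det M = 1}, monoid.mult = (**),
      one = Finite_Cartesian_Product.mat 1\<rparr>"

lemma special_linear_simps [simp]:
  "M \<in> carrier special_linear \<longleftrightarrow> Determinants.det M = 1"
  "M \<otimes>\<^bsub>special_linear\<^esub> N = M ** N"
  "\<one>\<^bsub>special_linear\<^esub> = Finite_Cartesian_Product.mat 1"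
  by (simp_all add: special_linear_def)

lemma monoid_special_linear: "monoid special_linear"
  by unfold_locales (simp_all add: det_mul matrix_mul_assoc)

definition volume3 :: "complex ^ 3 \<Rightarrow> complex ^ 3 \<Rightarrow> complex ^ 3 \<Rightarrow> complex" where
  "volume3 a b c = cdot a (ccross b c)"

lemma volume3_matrix: "volume3 (M *v a) (M *v b) (M *v c) = Determinants.det M * volume3 a b c"
  by (simp add: volume3_def ccross_matrix_vector cdot_cofactor)

lemma volume3_nondegenerate:
  assumes "\<And>p q. volume3 a p q = volume3 b p q"
  shows "a = b"
proof -
  have 1: "volume3 c (axis 2 1) (axis 3 1) = c $ 1" "volume3 c (axis 3 1) (axis 1 1) = c $ 2"
    "volume3 c (axis 1 1) (axis 2 1) = c $ 3" for c
    by (simp_all add: volume3_def complex3_simps axis_def)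
  have "a $ 1 = b $ 1" "a $ 2 = b $ 2" "a $ 3 = b $ 3"
    unfolding 1[symmetric] by (simp_all only: assms)
  then show ?thesis
    by (simp add: Finite_Cartesian_Product.vec_eq_iff forall_3)
qed

definition volume_frame :: "'a volume_space \<Rightarrow> (complex ^ 3 \<Rightarrow> 'a) \<Rightarrow> bool" where
  "volume_frame V F \<longleftrightarrow> bij_betw F UNIV (carrier V) \<and>
     (\<forall>a b. F (a + b) = F a \<oplus>\<^bsub>V\<^esub> F b) \<and> (\<forall>c a. F (c *s a) = c \<odot>\<^bsub>V\<^esub> F a) \<and>
     (\<forall>a b c. vol V (F a) (F b) (F c) = volume3 a b c)"

text \<open>
  In a basis \<open>u, v, w\<close> the form is \<open>\<omega>(u, v, w)\<close> times the determinant form. As it is not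
  zero, dividing \<open>u\<close> by this number turns the basis into one of volume 1.
\<close>

lemma volume_frame_exists:
  assumes "V \<in> Obj volume_space_cat"
  shows "\<exists>F. volume_frame V F"
proof -
  have obj: "vectorspace class_ring V" "vectorspace.fin_dim class_ring V"
    "vectorspace.dim class_ring V = 3" "volume_form V (vol V)"
    using assms by (simp_all add: volume_space_cat_def)
  interpret V: vectorspace class_ring V by fact
  obtain B where "finite B" "V.basis B"
    using V.finite_basis_exists[OF obj(2)] by blast
  with obj(3) have "card B = 3"
    by (metis V.dim_basis)
  then obtain u v w where B: "B = {u, v, w}" and distinct: "u \<noteq> v" "v \<noteq> w" "u \<noteq> w"
    by (auto simp: card_3_iff)
  have uvw: "u \<in> carrier V" "v \<in> carrier V" "w \<in> carrier V" and span: "V.span {u, v, w} = carrier V"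
    using \<open>V.basis B\<close> by (auto simp: V.basis_def B)
  have smult: "c \<odot>\<^bsub>V\<^esub> x \<in> carrier V" "(c + d) \<odot>\<^bsub>V\<^esub> x = c \<odot>\<^bsub>V\<^esub> x \<oplus>\<^bsub>V\<^esub> d \<odot>\<^bsub>V\<^esub> x"
    "(c * d) \<odot>\<^bsub>V\<^esub> x = c \<odot>\<^bsub>V\<^esub> (d \<odot>\<^bsub>V\<^esub> x)"
    if "x \<in> carrier V" for c d x
    using that V.smult_closed[of c x] V.smult_l_distr[of c d x] V.smult_assoc1[of c d x] by simp_all
  \<comment> \<open>\<open>v\<close> and \<open>w\<close> stay fixed; \<open>r\<close> is first \<open>u\<close>, later its rescaling.\<close>
  define L where "L r a = a $ 1 \<odot>\<^bsub>V\<^esub> r \<oplus>\<^bsub>V\<^esub> (a $ 2 \<odot>\<^bsub>V\<^esub> v \<oplus>\<^bsub>V\<^esub> a $ 3 \<odot>\<^bsub>V\<^esub> w)"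
    for r and a :: "complex ^ 3"
  have L_carrier: "L r a \<in> carrier V" if "r \<in> carrier V" for r a
    using that uvw by (simp add: L_def smult)
  have L_surj: "\<exists>a. x = L u a" if "x \<in> carrier V" for x
  proof -
    have "x \<in> V.span {u, v, w}"
      using that span by simp
    then obtain k where "x = V.lincomb k {u, v, w}"
      using V.finite_span[of "{u, v, w}"] uvw by auto
    also have "\<dots> = L u (vector [k u, k v, k w])"
      using uvw distinct by (simp add: V.lincomb_insert2 L_def smult)
    finally show ?thesis ..
  qed
  have lin: "linear_form V (\<lambda>z. vol V z x y)" "linear_form V (\<lambda>z. vol V x z y)"
      "linear_form V (\<lambda>z. vol V x y z)"
    and alt: "vol V x x y = 0" "vol V x y x = 0" "vol V y x x = 0"
    if "x \<in> carrier V" "y \<in> carrier V" for x y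
    using obj(4) that by (auto simp: volume_form_def alternating_3form_def)
  have add: "vol V (z \<oplus>\<^bsub>V\<^esub> t) x y = vol V z x y + vol V t x y"
      "vol V x (z \<oplus>\<^bsub>V\<^esub> t) y = vol V x z y + vol V x t y"
      "vol V x y (z \<oplus>\<^bsub>V\<^esub> t) = vol V x y z + vol V x y t"
    if "x \<in> carrier V" "y \<in> carrier V" "z \<in> carrier V" "t \<in> carrier V" for x y z t
    using lin[of x y] that by (simp_all add: linear_form_def)
  have scale: "vol V (c \<odot>\<^bsub>V\<^esub> z) x y = c * vol V z x y"
      "vol V x (c \<odot>\<^bsub>V\<^esub> z) y = c * vol V x z y"
      "vol V x y (c \<odot>\<^bsub>V\<^esub> z) = c * vol V x y z"
    if "x \<in> carrier V" "y \<in> carrier V" "z \<in> carrier V" for x y z c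
    using lin[of x y] that by (simp_all add: linear_form_def)
  have anti: "vol V y x z = - vol V x y z" "vol V x z y = - vol V x y z"
    if "x \<in> carrier V" "y \<in> carrier V" "z \<in> carrier V" for x y z
  proof -
    have "vol V (x \<oplus>\<^bsub>V\<^esub> y) (x \<oplus>\<^bsub>V\<^esub> y) z = vol V y x z + vol V x y z"
      using that by (simp add: add alt(1)[of x z] alt(1)[of y z])
    moreover have "vol V x (y \<oplus>\<^bsub>V\<^esub> z) (y \<oplus>\<^bsub>V\<^esub> z) = vol V x z y + vol V x y z"
      using that by (simp add: add alt(3)[of y x] alt(3)[of z x])
    ultimately have "vol V y x z + vol V x y z = 0" "vol V x z y + vol V x y z = 0"
      using that by (simp_all add: alt)
    then show "vol V y x z = - vol V x y z" "vol V x z y = - vol V x y z"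
      by (simp_all only: eq_neg_iff_add_eq_0)
  qed
  have vol_L: "vol V (L r a) (L r b) (L r c) = vol V r v w * volume3 a b c"
    if r: "r \<in> carrier V" for r a b c
  proof -
    have "vol V v r w = - vol V r v w" "vol V v w r = vol V r v w" "vol V w v r = - vol V r v w"
      "vol V w r v = vol V r v w" "vol V r w v = - vol V r v w"
      using anti(1)[of r v w] anti(2)[of r v w] anti(2)[of v r w] anti(1)[of r w v]
        anti(1)[of v w r] r uvw
      by simp_all
    then show ?thesis
      using r uvw by (simp add: L_def add scale alt smult)
        (simp add: volume3_def complex3_simps algebra_simps)
  qed
  have ne: "vol V u v w \<noteq> 0"
  proof
    assume 0: "vol V u v w = 0"
    obtain x y z where "x \<in> carrier V" "y \<in> carrier V" "z \<in> carrier V" "vol V x y z \<noteq> 0"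
      using obj(4) by (auto simp: volume_form_def)
    with L_surj[of x] L_surj[of y] L_surj[of z] uvw show False
      by (auto simp: vol_L 0)
  qed
  define r where "r = inverse (vol V u v w) \<odot>\<^bsub>V\<^esub> u"
  have r: "r \<in> carrier V"
    using uvw by (simp add: r_def smult)
  have vol_r: "vol V r v w = 1"
    using uvw ne by (simp add: r_def scale)
  have "bij_betw (L r) UNIV (carrier V)"
  proof (rule bij_betw_imageI)
    \<comment> \<open>The coordinates of a vector can be read off from volumes.\<close>
    show "inj (L r)"
    proof (rule injI)
      fix a b assume "L r a = L r b"
      then have "volume3 a p q = volume3 b p q" for p q
        using vol_L[OF r, of a p q] vol_L[OF r, of b p q] by (simp add: vol_r)
      then show "a = b"
        by (rule volume3_nondegenerate)
    qed
    have "L u a = L r (vector [vol V u v w * a $ 1, a $ 2, a $ 3])" for a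
    proof -
      have "vol V u v w * a $ 1 * inverse (vol V u v w) = a $ 1"
        using ne by simp
      with uvw show ?thesis
        by (simp only: L_def r_def vector_3 flip: smult(3))
    qed
    with L_surj L_carrier[OF r] show "range (L r) = carrier V"
      by auto
  qed
  moreover have "L r (a + b) = L r a \<oplus>\<^bsub>V\<^esub> L r b" for a b
    using r uvw by (simp add: L_def smult V.a_ac)
  moreover have "L r (c *s a) = c \<odot>\<^bsub>V\<^esub> L r a" for a c
    using r uvw by (simp add: L_def smult V.smult_r_distr)
  moreover have "vol V (L r a) (L r b) (L r c) = volume3 a b c" for a b c
    by (simp add: vol_L r vol_r)
  ultimately show ?thesis
    unfolding volume_frame_def by blast
qed

text \<open>
  A linear map is a matrix \<open>M\<close> in coordinates and multiplies volumes by \<open>det M\<close>.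
\<close>

lemma volume_space_Hom_iff:
  assumes F: "volume_frame V F" and K: "volume_frame W K"
  shows "f \<in> Hom volume_space_cat V W \<longleftrightarrow> f \<in> extensional (carrier V) \<and>
    (\<exists>M. Determinants.det M = 1 \<and> (\<forall>a. f (F a) = K (M *v a)))"
proof -
  note F = F[unfolded volume_frame_def] and K = K[unfolded volume_frame_def]
  have F_hom: "F (a + b) = F a \<oplus>\<^bsub>V\<^esub> F b" "F (c *s a) = c \<odot>\<^bsub>V\<^esub> F a"
    and K_hom: "K (a + b) = K a \<oplus>\<^bsub>W\<^esub> K b" "K (c *s a) = c \<odot>\<^bsub>W\<^esub> K a" for a b c
    using F K by simp_all
  have F_in: "F a \<in> carrier V" and K_in: "K a \<in> carrier W" for a
    using F K by (auto simp: bij_betw_def)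
  have K_inj: "K a = K b \<longleftrightarrow> a = b" for a b
    using K by (auto simp: bij_betw_def inj_eq)
  have carrier_V: "carrier V = range F" and carrier_W: "carrier W = range K"
    using F K by (simp_all add: bij_betw_def)
  have "\<exists>M. Determinants.det M = 1 \<and> (\<forall>a. f (F a) = K (M *v a))" if f: "f \<in> Hom volume_space_cat V W"
  proof -
    have f_add: "f (F a \<oplus>\<^bsub>V\<^esub> F b) = f (F a) \<oplus>\<^bsub>W\<^esub> f (F b)"
      and f_smult: "f (c \<odot>\<^bsub>V\<^esub> F a) = c \<odot>\<^bsub>W\<^esub> f (F a)" and f_in: "f (F a) \<in> carrier W" for a b c
      using f F_in by (auto simp: volume_space_cat_def module_hom_def)
    have f_vol: "vol W (f (F a)) (f (F b)) (f (F c)) = vol V (F a) (F b) (F c)" for a b c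
      using f F_in by (simp add: volume_space_cat_def preserves_vol_def)
    from f_in have "\<exists>b. f (F a) = K b" for a
      unfolding carrier_W by blast
    then obtain p where p: "f (F a) = K (p a)" for a
      by metis
    have "K (p (a + b)) = K (p a + p b)" and "K (p (c *s a)) = K (c *s p a)" for a b c
      using f_add[of a b] f_smult[of c a] by (simp_all add: K_hom p flip: F_hom)
    then have "p (a + b) = p a + p b" and "p (c *s a) = c *s p a" for a b c
      by (simp_all only: K_inj)
    then have "Vector_Spaces.linear (*s) (*s) p"
      by unfold_locales simp_all
    then have M: "p a = matrix p *v a" for a
      by (simp add: matrix_works)
    have "Determinants.det (matrix p) * volume3 a b c = volume3 a b c" for a b c
      using f_vol[of a b c] F K by (simp add: p M flip: volume3_matrix)
    from this[of "axis 1 1" "axis 2 1" "axis 3 1"] have "Determinants.det (matrix p) = 1"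
      by (simp add: volume3_def complex3_simps axis_def)
    with p M show ?thesis
      by auto
  qed
  moreover have "f \<in> Hom volume_space_cat V W"
    if "f \<in> extensional (carrier V)" "Determinants.det M = 1" "\<And>a. f (F a) = K (M *v a)" for M
  proof -
    have "f \<in> module_hom class_ring V W"
      using that K_in unfolding module_hom_def carrier_V
      by (auto simp: matrix_vector_right_distrib vector_scalar_commute simp flip: F_hom K_hom)
    moreover have "preserves_vol V W f"
      using that F K unfolding preserves_vol_def carrier_V by (auto simp: volume3_matrix)
    ultimately show ?thesis
      using that by (simp add: volume_space_cat_def)
  qed
  moreover have "f \<in> extensional (carrier V)" if "f \<in> Hom volume_space_cat V W"
    using that by (simp add: volume_space_cat_def)
  ultimately show ?thesis
    by blast
qed

lemma framed_volume_space_cat: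
  "framed_category special_linear (volume_space_cat :: ('a volume_space, 'a \<Rightarrow> 'a) category)
     carrier (\<lambda>V. SOME F. volume_frame V F) (*v)"
proof -
  interpret monoid special_linear by (rule monoid_special_linear)
  have frame: "volume_frame V (SOME F. volume_frame V F)" if "V \<in> Obj volume_space_cat"
    for V :: "'a volume_space"
    using volume_frame_exists[OF that] by (rule someI_ex)
  show ?thesis
  proof
    fix V W :: "'a volume_space" and f
    assume V: "V \<in> Obj volume_space_cat" and "W \<in> Obj volume_space_cat"
    then show "f \<in> Hom volume_space_cat V W \<longleftrightarrow> f \<in> extensional (carrier V) \<and>
        (\<exists>M \<in> carrier special_linear. \<forall>a. f ((SOME F. volume_frame V F) a) =
          (SOME F. volume_frame W F) (M *v a))"
      by (subst volume_space_Hom_iff[OF frame frame]) auto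
  qed (use frame in \<open>auto simp: volume_frame_def volume_space_cat_def matrix_vector_mul_assoc matrix_eq\<close>)
qed

section \<open>Rooted algebras are framed by the special linear group\<close>

text \<open>
  An isomorphism to the bioctonions moves the root to some nontrivial root there, and transitivity
  corrects it by an automorphism.
\<close>

lemma rooted_frame_exists:
  assumes "A \<in> Obj rooted_bioctonion_cat"
  shows "\<exists>F. F \<in> algebra_isos bioctonions A \<and> F standard_root = root A"
proof -
  obtain \<phi> where \<phi>: "\<phi> \<in> algebra_isos A bioctonions" and A: "complex_algebra A"
    and root: "nontrivial_root A (root A)"
    using assms by (auto simp: rooted_bioctonion_cat_def)
  have "nontrivial_root bioctonions (\<phi> (root A))"
    by (rule nontrivial_root_image) (fact A complex_algebra_bioctonions \<phi> root)+
  then have "in_standard_orbit (\<phi> (root A))"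
    by (intro root_in_standard_orbit)
      (simp_all add: nontrivial_root_iff complex_algebra_bioctonions)
  then obtain f where f: "f \<in> algebra_isos bioctonions bioctonions"
    and f_root: "f (\<phi> (root A)) = standard_root"
    by (auto simp: in_standard_orbit_def)
  have comp: "f \<circ> \<phi> \<in> algebra_isos A bioctonions"
    by (rule algebra_isos_comp[OF \<phi> f])
  have "inv_into (carrier A) (f \<circ> \<phi>) ((f \<circ> \<phi>) (root A)) = root A"
    using root algebra_isosD(1)[OF comp]
    by (intro inv_into_f_f) (simp_all add: bij_betw_def nontrivial_root_def)
  then show ?thesis
    using algebra_isos_inv[OF A comp] f_root by auto
qed

lemma unimodular_action_standard_root: "unimodular_action M standard_root = standard_root"
  by (simp add: standard_root_def)

text \<open>
  In coordinates a morphism becomes an automorphism of the bioctonions that fixes the standard root.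
\<close>

lemma rooted_Hom_iff:
  assumes A: "complex_algebra A" and B: "complex_algebra B"
    and F: "F \<in> algebra_isos bioctonions A" "F standard_root = root A"
    and K: "K \<in> algebra_isos bioctonions B" "K standard_root = root B"
  shows "f \<in> Hom rooted_bioctonion_cat A B \<longleftrightarrow> f \<in> extensional (carrier A) \<and>
    (\<exists>M. Determinants.det M = 1 \<and> (\<forall>x. f (F x) = K (unimodular_action M x)))"
proof -
  note F_inv = algebra_isos_inv[OF complex_algebra_bioctonions F(1)]
    and K_inv = algebra_isos_inv[OF complex_algebra_bioctonions K(1)]
  have F_bij: "bij_betw F UNIV (carrier A)" and K_bij: "bij_betw K UNIV (carrier B)"
    using algebra_isosD(1)[OF F(1)] algebra_isosD(1)[OF K(1)] by simp_all
  have "\<exists>M. Determinants.det M = 1 \<and> (\<forall>x. f (F x) = K (unimodular_action M x))"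
    if f: "f \<in> Hom rooted_bioctonion_cat A B"
  proof -
    have f_iso: "f \<in> algebra_isos A B" and f_root: "f (root A) = root B"
      using f by (simp_all add: rooted_bioctonion_cat_def)
    define g where "g = inv_into UNIV K \<circ> (f \<circ> F)"
    have "f (F x) \<in> carrier B" for x
      using algebra_isosD(2)[OF F(1)] algebra_isosD(2)[OF f_iso] by simp
    then have Kg: "K (g x) = f (F x)" for x
      using K_bij by (simp add: g_def f_inv_into_f bij_betw_def)
    have "g \<in> algebra_isos bioctonions bioctonions"
      unfolding g_def using K_inv
      by (intro algebra_isos_comp[OF algebra_isos_comp[OF F(1) f_iso]]) simp
    moreover have "g standard_root = standard_root"
      using K_bij by (simp add: g_def F(2) f_root inv_f_f bij_betw_def flip: K(2))
    ultimately show ?thesis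
      using automorphism_fixing_standard_root[of g] Kg by metis
  qed
  moreover have "f \<in> Hom rooted_bioctonion_cat A B"
    if ext: "f \<in> extensional (carrier A)" and M: "Determinants.det M = 1"
      and f: "\<And>x. f (F x) = K (unimodular_action M x)" for M
  proof -
    have "K \<circ> (unimodular_action M \<circ> inv_into UNIV F) \<in> algebra_isos A B"
      using F_inv unimodular_action_automorphism[OF M]
      by (intro algebra_isos_comp[OF algebra_isos_comp K(1)]) simp_all
    then have "f \<in> algebra_isos A B"
    proof (rule algebra_isos_cong[OF A])
      fix z assume "z \<in> carrier A"
      then show "f z = (K \<circ> (unimodular_action M \<circ> inv_into UNIV F)) z"
        using F_bij f[of "inv_into UNIV F z"] by (simp add: f_inv_into_f bij_betw_def)
    qed
    moreover have "f (root A) = root B"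
      using f[of standard_root] by (simp add: F(2) K(2) unimodular_action_standard_root)
    ultimately show ?thesis
      using ext by (simp add: rooted_bioctonion_cat_def)
  qed
  moreover have "f \<in> extensional (carrier A)" if "f \<in> Hom rooted_bioctonion_cat A B"
    using that by (simp add: rooted_bioctonion_cat_def)
  ultimately show ?thesis
    by blast
qed

lemma framed_rooted_bioctonion_cat:
  "framed_category special_linear (rooted_bioctonion_cat :: ('b rooted_algebra, 'b \<Rightarrow> 'b) category)
     carrier (\<lambda>A. SOME F. F \<in> algebra_isos bioctonions A \<and> F standard_root = root A)
     unimodular_action"
proof -
  interpret monoid special_linear by (rule monoid_special_linear)
  let ?frame = "\<lambda>A :: 'b rooted_algebra.
    SOME F. F \<in> algebra_isos bioctonions A \<and> F standard_root = root A"
  have frame: "?frame A \<in> algebra_isos bioctonions A" "?frame A standard_root = root A"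
    if "A \<in> Obj rooted_bioctonion_cat" for A
    using someI_ex[OF rooted_frame_exists[OF that]] by simp_all
  show ?thesis
  proof
    fix A :: "'b rooted_algebra" assume A: "A \<in> Obj rooted_bioctonion_cat"
    show "bij_betw (?frame A) UNIV (carrier A)"
      using algebra_isosD(1)[OF frame(1)[OF A]] by simp
    fix B :: "'b rooted_algebra" and f assume B: "B \<in> Obj rooted_bioctonion_cat"
    have "complex_algebra A" "complex_algebra B"
      using A B by (simp_all add: rooted_bioctonion_cat_def)
    from rooted_Hom_iff[OF this frame[OF A] frame[OF B]]
    show "f \<in> Hom rooted_bioctonion_cat A B \<longleftrightarrow> f \<in> extensional (carrier A) \<and>
        (\<exists>M \<in> carrier special_linear. \<forall>x. f (?frame A x) = ?frame B (unimodular_action M x))"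
      by auto
  next
    fix M N :: "complex ^ 3 ^ 3" assume eq: "\<And>x. unimodular_action M x = unimodular_action N x"
    then show "M = N"
      using eq[of "(0, a, 0, 0)" for a] by (simp add: matrix_eq)
  qed (simp_all add: rooted_bioctonion_cat_def unimodular_action_one unimodular_action_mult)
qed

section \<open>Objects with carriers in a given type\<close>

text \<open>
  The models have the cardinality of the continuum, so they embed into every type into which the
  complex numbers embed. Their structure is then copied along the embedding.
\<close>

lemma infinite_times_embedding:
  assumes "infinite (UNIV :: 'a set)"
  obtains e :: "'a \<times> 'a \<Rightarrow> 'a" where "inj e"
proof -
  obtain e where "bij_betw e ((UNIV :: 'a set) \<times> (UNIV :: 'a set)) (UNIV :: 'a set)"
    using card_of_Times_same_infinite[OF assms] card_of_ordIso by blast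
  then show thesis
    by (intro that[of e]) (simp add: bij_betw_def)
qed

lemma complex3_embedding:
  obtains e :: "complex ^ 3 \<Rightarrow> complex" where "inj e"
proof -
  obtain p :: "complex \<times> complex \<Rightarrow> complex" where p: "inj p"
    using infinite_times_embedding infinite_UNIV_char_0 by blast
  have "inj (\<lambda>a :: complex ^ 3. p (a $ 1, p (a $ 2, a $ 3)))"
    by (auto intro!: injI dest!: injD[OF p] simp: Finite_Cartesian_Product.vec_eq_iff forall_3)
  then show thesis
    by (rule that)
qed

lemma bioctonion_embedding:
  obtains e :: "bioctonion \<Rightarrow> complex" where "inj e"
proof -
  obtain p :: "complex \<times> complex \<Rightarrow> complex" where p: "inj p"
    using infinite_times_embedding infinite_UNIV_char_0 by blast
  obtain q :: "complex ^ 3 \<Rightarrow> complex" where q: "inj q"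
    by (rule complex3_embedding)
  have "inj (\<lambda>(\<alpha>, a, a', \<alpha>'). p (p (\<alpha>, \<alpha>'), p (q a, q a')))"
    by (auto intro!: injI dest!: injD[OF p] injD[OF q])
  then show thesis
    by (rule that)
qed

lemma volume_space_exists:
  fixes e :: "complex ^ 3 \<Rightarrow> 'a"
  assumes e: "inj e"
  shows "Obj (volume_space_cat :: ('a volume_space, 'a \<Rightarrow> 'a) category) \<noteq> {}"
proof -
  define V :: "'a volume_space" where
    "V = \<lparr>carrier = range e, monoid.mult = (\<lambda>_ _. e 0), one = e 0, zero = e 0,
          add = (\<lambda>x y. e (inv_into UNIV e x + inv_into UNIV e y)),
          smult = (\<lambda>c x. e (c *s inv_into UNIV e x)),
          vol = (\<lambda>x y z. volume3 (inv_into UNIV e x) (inv_into UNIV e y) (inv_into UNIV e z))\<rparr>"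
  have inv_e: "inv_into UNIV e (e a) = a" for a
    using e by (rule inv_f_f)
  define h where "h = e \<circ> (\<lambda>v. vector [vec_index v 0, vec_index v 1, vec_index v 2])"
  have bij: "bij_betw h (carrier (module_vec TYPE(complex) 3)) (carrier V)"
    using bij_betw_trans[OF bij_betw_carrier_vec_3 inj_on_imp_bij_betw[OF e]]
    by (simp add: V_def module_vec_simps h_def)
  have "h \<in> module_hom class_ring (module_vec TYPE(complex) 3) V"
    by (auto simp: module_hom_def module_vec_simps h_def V_def inv_e
        intro!: arg_cong[of _ _ e]) (simp_all add: complex3_simps)
  moreover have "h \<zero>\<^bsub>module_vec TYPE(complex) 3\<^esub> = \<zero>\<^bsub>V\<^esub>"
    by (auto simp: module_vec_simps h_def V_def intro!: arg_cong[of _ _ e]) (simp add: complex3_simps)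
  ultimately have "vectorspace class_ring V" "vectorspace.fin_dim class_ring V"
    "vectorspace.dim class_ring V = 3"
    using vectorspace_transfer[OF vec_vs _ bij]
    by (simp_all add: vec_space.fin_dim vec_space.dim_is_n)
  moreover have "volume_form V (vol V)"
    unfolding volume_form_def
  proof
    show "alternating_3form V (vol V)"
      unfolding alternating_3form_def linear_form_def
      by (auto simp: V_def inv_e) (simp_all add: volume3_def complex3_simps algebra_simps)
    have "vol V (e (axis 1 1)) (e (axis 2 1)) (e (axis 3 1)) \<noteq> 0"
      by (simp add: V_def inv_e volume3_def complex3_simps axis_def)
    then show "\<exists>x \<in> carrier V. \<exists>y \<in> carrier V. \<exists>z \<in> carrier V. vol V x y z \<noteq> 0"
      by (auto simp: V_def)
  qed
  ultimately have "V \<in> Obj volume_space_cat"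
    by (simp add: volume_space_cat_def)
  then show ?thesis
    by blast
qed


lemma rooted_algebra_exists:
  fixes e :: "bioctonion \<Rightarrow> 'b"
  assumes e: "inj e"
  shows "Obj (rooted_bioctonion_cat :: ('b rooted_algebra, 'b \<Rightarrow> 'b) category) \<noteq> {}"
proof -
  define A :: "'b rooted_algebra" where
    "A = \<lparr>carrier = range e,
          monoid.mult = (\<lambda>x y. e (bioct_mult (inv_into UNIV e x) (inv_into UNIV e y))),
          one = e (1, 0, 0, 1), zero = e 0,
          add = (\<lambda>x y. e (inv_into UNIV e x + inv_into UNIV e y)),
          smult = (\<lambda>c x. e (bioct_smult c (inv_into UNIV e x))),
          root = e standard_root\<rparr>"
  have iso: "e \<in> algebra_isos bioctonions A"
    using e by (intro algebra_isosI) (simp_all add: A_def inv_f_f bij_betw_def)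
  have A: "complex_algebra A"
    by (rule complex_algebra_transfer[OF complex_algebra_bioctonions iso]) (simp add: A_def)
  have "nontrivial_root bioctonions standard_root"
    by (auto simp: nontrivial_root_iff[OF complex_algebra_bioctonions] standard_root_def complex3_simps)
  then have "nontrivial_root A (root A)"
    using nontrivial_root_image[OF complex_algebra_bioctonions A iso] by (simp add: A_def)
  moreover have "algebra_isos A bioctonions \<noteq> {}"
    using algebra_isos_inv[OF complex_algebra_bioctonions iso] by blast
  ultimately have "A \<in> Obj rooted_bioctonion_cat"
    using A by (simp add: rooted_bioctonion_cat_def)
  then show ?thesis
    by blast
qed

section \<open>The equivalence\<close>

theorem theorem8:
  assumes "\<exists>e :: complex \<Rightarrow> 'a. inj e"
    and "\<exists>e :: complex \<Rightarrow> 'b. inj e"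
  shows "\<exists>Z. cat_functor (volume_space_cat :: ('a volume_space, 'a \<Rightarrow> 'a) category)
               (rooted_bioctonion_cat :: ('b rooted_algebra, 'b \<Rightarrow> 'b) category) Z \<and>
             is_equivalence volume_space_cat rooted_bioctonion_cat Z"
proof -
  obtain e :: "complex \<Rightarrow> 'a" and e' :: "complex \<Rightarrow> 'b" where "inj e" "inj e'"
    using assms by blast
  moreover obtain p :: "complex ^ 3 \<Rightarrow> complex" where "inj p"
    by (rule complex3_embedding)
  moreover obtain q :: "bioctonion \<Rightarrow> complex" where "inj q"
    by (rule bioctonion_embedding)
  ultimately have "inj (e \<circ> p)" "inj (e' \<circ> q)"
    by (simp_all add: inj_compose)
  then have "Obj (volume_space_cat :: ('a volume_space, 'a \<Rightarrow> 'a) category) \<noteq> {}"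
    and "Obj (rooted_bioctonion_cat :: ('b rooted_algebra, 'b \<Rightarrow> 'b) category) \<noteq> {}"
    by (simp_all add: volume_space_exists rooted_algebra_exists)
  from framed_categories_equivalent[OF framed_volume_space_cat framed_rooted_bioctonion_cat this]
  show ?thesis
    unfolding is_equivalence_def by blast
qed

end
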